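(* Consider the perturbed linear time varying system $\dot x=A(t)x+g(t,x)$, $x(t_0)=x_0$, where $t\ge t_0\ge 0$, $x\in\mathbb{R}^n$, $A$ is a continuous $n\times n$ real matrix function of $t$, and $g:\mathbb{R}_+\times\mathbb{R}^n\to\mathbb{R}^n$ is the perturbation term (it is not required that $g(t,0)=0$). Assume that the nominal system $\dot x=A(t)x$ is uniformly asymptotically stable, and suppose that $$\|g(t,x)\|\le\phi(t)\,\omega(\|x\|)+\lambda(t)$$ where - $\phi\in L^p(\mathbb{R}_+,\mathbb{R}_+)$ with $p\in[1,\infty]$; - $\omega:\mathbb{R}_+\to\mathbb{R}_+$ is a nondecreasing continuous function such that $\lim_{s\to\infty}\frac{\omega(s)}{s^\ell}=0$, with $\ell\in(0,1]$ if $p=1$, or $\ell\in(0,1)$ if $p\in(1,\infty]$; - $\lambda\in L^r(\mathbb{R}_+,\mathbb{R}_+)$ with $r\in[1,\infty]$, or $\lim_{t\to\infty}\lambda(t)=0$. Then: (i) The solution $x$ of the perturbed system, if there exists one, is defined on $[t_0,\infty)$. (ii) The perturbed system is globally practically uniformly exponentially stable. (iii) If $p$ and $r$ are in $[1,\infty)$, then $\lim_{t\to\infty}\|x(t)\|=0$.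
   Context: $\mathbb{R}_+=[0,\infty)$. $\|\cdot\|$ denotes a norm on $\mathbb{R}^n$ and the corresponding norm of matrices. The functions $\phi$ and $\lambda$ are functions of $t\in\mathbb{R}_+$, and the bound on $g$ is meant for all $(t,x)\in\mathbb{R}_+\times\mathbb{R}^n$. The linear system $\dot x=A(t)x$ is uniformly asymptotically stable if and only if there exist constants $c>0$ and $\gamma>0$ such that for all $t_0\ge0$, $\|R(t,t_0)\|\le c\,e^{-\gamma(t-t_0)}$ for all $t\ge t_0$, where $R(t,t_0)$ denotes the state transition matrix of $\dot x=A(t)x$. For $\rho\ge0$ let $\mathcal{B}_\rho=\{x\in\mathbb{R}^n:\|x\|\le\rho\}$. The ball $\mathcal{B}_\rho$ is globally uniformly exponentially stable if there exist $\mu>0$ and $C\ge0$ such that for all $t_0\in\mathbb{R}_+$ and all $x_0\in\mathbb{R}^n$, the solution $x$ of the perturbed system with $x(t_0)=x_0$ satisfies $\|x(t)\|\le C\|x_0\|e^{-\mu(t-t_0)}+\rho$ for all $t\ge t_0$. The perturbed system is globally practically uniformly exponentially stable if there exists $\rho>0$ such that $\mathcal{B}_\rho$ is globally uniformly exponentially stable.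
   Formalization: In the case λ(t)→0, λ is also assumed locally integrable on [0,∞); in (i), a non-continuable (Carathéodory) solution is shown to be defined on [t0,∞) provided the system is locally solvable through each point of it; without these the claims fail. *)

theory Defs
  imports "HOL-Analysis.Analysis"
begin

definition is_norm :: "('a::real_vector \<Rightarrow> real) \<Rightarrow> bool" where
  "is_norm N \<longleftrightarrow>
     (\<forall>x. 0 \<le> N x) \<and> (\<forall>x. N x = 0 \<longleftrightarrow> x = 0) \<and>
     (\<forall>a x. N (a *\<^sub>R x) = \<bar>a\<bar> * N x) \<and> (\<forall>x y. N (x + y) \<le> N x + N y)"

definition induced_norm :: "(real^'n \<Rightarrow> real) \<Rightarrow> real^'n^'n \<Rightarrow> real" where
  "induced_norm N M = (SUP x\<in>{x. N x = 1}. N (M *v x))"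

text \<open>Membership of a real function in $L^p$ of a measure space, $1 \le p \le \infty$.\<close>

definition in_Lp :: "'a measure \<Rightarrow> ennreal \<Rightarrow> ('a \<Rightarrow> real) \<Rightarrow> bool" where
  "in_Lp M p f \<longleftrightarrow> f \<in> borel_measurable M \<and>
     (if p = \<infinity> then \<exists>C. AE t in M. \<bar>f t\<bar> \<le> C
      else integrable M (\<lambda>t. \<bar>f t\<bar> powr enn2real p))"

definition locally_integrable_halfline :: "(real \<Rightarrow> real) \<Rightarrow> bool" where
  "locally_integrable_halfline f \<longleftrightarrow> (\<forall>T\<ge>0. f absolutely_integrable_on {0..T})"

text \<open>
  The bounds on the perturbation are integrability conditions in time and no regularity of the
  right-hand side is assumed, so solutions are understood in the sense of Caratheodory, i.e. as
  solutions of the integral equation with a Lebesgue integral.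
  The domain \<open>I\<close> is an interval with least element \<open>t0\<close>; values of \<open>x\<close> outside \<open>I\<close> are irrelevant.
\<close>

definition solution_on ::
  "(real \<Rightarrow> 'a \<Rightarrow> 'a::euclidean_space) \<Rightarrow> real \<Rightarrow> 'a \<Rightarrow> real set \<Rightarrow> (real \<Rightarrow> 'a) \<Rightarrow> bool" where
  "solution_on f t0 x0 I x \<longleftrightarrow>
     is_interval I \<and> t0 \<in> I \<and> I \<subseteq> {t0..} \<and>
     (\<forall>t\<in>I. (\<lambda>s. f s (x s)) absolutely_integrable_on {t0..t} \<and>
            x t = x0 + integral {t0..t} (\<lambda>s. f s (x s)))"

definition maximal_solution_on ::
  "(real \<Rightarrow> 'a \<Rightarrow> 'a::euclidean_space) \<Rightarrow> real \<Rightarrow> 'a \<Rightarrow> real set \<Rightarrow> (real \<Rightarrow> 'a) \<Rightarrow> bool" where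
  "maximal_solution_on f t0 x0 I x \<longleftrightarrow>
     solution_on f t0 x0 I x \<and>
     (\<forall>J y. solution_on f t0 x0 J y \<and> I \<subseteq> J \<and> (\<forall>t\<in>I. y t = x t) \<longrightarrow> J = I)"

definition locally_solvable ::
  "(real \<Rightarrow> 'a \<Rightarrow> 'a::euclidean_space) \<Rightarrow> real \<Rightarrow> 'a \<Rightarrow> bool" where
  "locally_solvable f t0 x0 \<longleftrightarrow> (\<exists>\<epsilon>>0. \<exists>x. solution_on f t0 x0 {t0..<t0 + \<epsilon>} x)"

definition perturbed_rhs ::
  "(real \<Rightarrow> real^'n^'n) \<Rightarrow> (real \<Rightarrow> real^'n \<Rightarrow> real^'n) \<Rightarrow> real \<Rightarrow> real^'n \<Rightarrow> real^'n" where
  "perturbed_rhs A g t x = A t *v x + g t x"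

text \<open>
  \<open>R t t0\<close> is the state transition matrix of the linear system with matrix \<open>A\<close>:
  the matrix solution that equals the identity at time \<open>t0\<close>.
  For continuous \<open>A\<close> it exists and is unique on the half-line.
\<close>

definition state_transition_matrix ::
  "(real \<Rightarrow> real^'n^'n) \<Rightarrow> (real \<Rightarrow> real \<Rightarrow> real^'n^'n) \<Rightarrow> bool" where
  "state_transition_matrix A R \<longleftrightarrow>
     (\<forall>t0\<ge>0. R t0 t0 = mat 1 \<and>
        (\<forall>t\<ge>0. ((\<lambda>s. R s t0) has_vector_derivative A t ** R t t0) (at t within {0..})))"

definition uniformly_asymptotically_stable ::
  "(real^'n \<Rightarrow> real) \<Rightarrow> (real \<Rightarrow> real^'n^'n) \<Rightarrow> bool" where
  "uniformly_asymptotically_stable N A \<longleftrightarrow>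
     (\<exists>R. state_transition_matrix A R \<and>
        (\<exists>c>0. \<exists>\<gamma>>0. \<forall>t0\<ge>0. \<forall>t\<ge>t0. induced_norm N (R t t0) \<le> c * exp (- \<gamma> * (t - t0))))"

text \<open>
  Global uniform exponential stability of the ball \<open>{x. N x \<le> \<rho>}\<close>. The estimate is required of
  every solution, on all of its interval of existence.
\<close>

definition ball_GUES ::
  "('a \<Rightarrow> real) \<Rightarrow> (real \<Rightarrow> 'a \<Rightarrow> 'a::euclidean_space) \<Rightarrow> real \<Rightarrow> bool" where
  "ball_GUES N f \<rho> \<longleftrightarrow>
     (\<exists>\<mu>>0. \<exists>C\<ge>0. \<forall>t0\<ge>0. \<forall>x0 I x. solution_on f t0 x0 I x \<longrightarrow>
        (\<forall>t\<in>I. N (x t) \<le> C * N x0 * exp (- \<mu> * (t - t0)) + \<rho>))"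

definition globally_practically_uniformly_exponentially_stable ::
  "('a \<Rightarrow> real) \<Rightarrow> (real \<Rightarrow> 'a \<Rightarrow> 'a::euclidean_space) \<Rightarrow> bool" where
  "globally_practically_uniformly_exponentially_stable N f \<longleftrightarrow> (\<exists>\<rho>>0. ball_GUES N f \<rho>)"

end

theory Submission
  imports Defs
begin

text \<open>
  With respect to the flow \<open>R\<close> of the nominal system, the adapted norm
  \<open>V s v = sup {exp (\<gamma> (t - s)) |R t s v| : t \<ge> s}\<close> is equivalent to the given one and contracts exactly
  like \<open>exp (- \<gamma> (t - s))\<close> along the flow. Over a short time interval a solution of the perturbed
  system deviates from the flow by the integral of the perturbation up to higher order, so
  \<open>V\<close> along a solution obeys a Gronwall inequality; no variation of constants formula is needed.

  The hypotheses enter as follows. For every \<open>\<epsilon>\<close>, sublinearity of \<open>\<omega>\<close> gives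
  \<open>\<omega> s \<le> \<epsilon> s + K\<close>, and an \<open>L\<^sup>p\<close> function is at most a constant plus an integrable function, where
  the constant may be chosen arbitrarily small if \<open>p < \<infinity>\<close>. Hence
  \<open>|g t x| \<le> (\<delta> + \<psi> t) |x| + h t\<close> with \<open>\<delta>\<close> small compared to \<open>\<gamma>\<close>, \<open>\<psi>\<close> integrable, and \<open>h\<close> at most a
  constant plus an integrable function. The \<open>\<delta>\<close> costs part of the decay rate, \<open>\<psi>\<close> costs a factor, and
  \<open>h\<close> contributes the radius of the ball.
\<close>

section \<open>Norms and transition matrices\<close>

text \<open>The hypotheses speak of \<open>N\<close>, the analysis is done in the Euclidean norm.
  Expansion in the basis gives the upper bound, which makes \<open>N\<close> Lipschitz; so
  \<open>N\<close> attains a positive minimum on the compact unit sphere, and homogeneity turns it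
  into the lower bound.\<close>

lemma is_norm_equivalent:
  fixes N :: "'a::euclidean_space \<Rightarrow> real"
  assumes "is_norm N"
  obtains a b where "a > 0" "b > 0" "\<And>x. N x \<le> a * norm x" "\<And>x. norm x \<le> b * N x"
proof -
  have N: "\<And>x. 0 \<le> N x" "\<And>x. N x = 0 \<longleftrightarrow> x = 0"
    "\<And>a x. N (a *\<^sub>R x) = \<bar>a\<bar> * N x" "\<And>x y. N (x + y) \<le> N x + N y"
    using assms by (auto simp: is_norm_def)
  define a where "a = (\<Sum>b\<in>Basis. N b) + 1"
  have a: "a > 0" unfolding a_def by (intro add_nonneg_pos sum_nonneg) (auto simp: N)
  have Nsum: "N (sum h S) \<le> (\<Sum>i\<in>S. N (h i))" if "finite S" for S and h :: "'a \<Rightarrow> 'a"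
    using that
  proof (induction S rule: finite_induct)
    case empty then show ?case using N(2)[of 0] by simp
  next
    case (insert i S) then show ?case using N(4)[of "h i" "sum h S"] by simp
  qed
  have up: "N x \<le> a * norm x" for x
  proof -
    have "N x = N (\<Sum>b\<in>Basis. (x \<bullet> b) *\<^sub>R b)" by (simp add: euclidean_representation)
    also have "\<dots> \<le> (\<Sum>b\<in>Basis. N ((x \<bullet> b) *\<^sub>R b))" by (rule Nsum) simp
    also have "\<dots> \<le> (\<Sum>b\<in>Basis. norm x * N b)"
      by (intro sum_mono) (auto simp: N intro!: mult_right_mono Basis_le_norm)
    also have "\<dots> \<le> a * norm x" by (simp add: a_def sum_distrib_left algebra_simps)
    finally show ?thesis .
  qed
  have "a-lipschitz_on UNIV N"
  proof (rule lipschitz_onI)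
    fix x y
    have "N x \<le> N (x - y) + N y" "N y \<le> N (y - x) + N x"
      using N(4)[of "x - y" y] N(4)[of "y - x" x] by auto
    moreover have "N (y - x) = N (x - y)" using N(3)[of "-1" "x - y"] by simp
    ultimately have "\<bar>N x - N y\<bar> \<le> N (x - y)" by linarith
    also have "\<dots> \<le> a * norm (x - y)" by (rule up)
    finally show "dist (N x) (N y) \<le> a * dist x y" by (simp add: dist_norm)
  qed (use a in simp)
  then have "continuous_on (sphere 0 1) N"
    using continuous_on_subset lipschitz_on_continuous_on by blast
  moreover have "sphere (0::'a) 1 \<noteq> {}" by simp
  ultimately obtain z where z: "z \<in> sphere 0 1" "\<And>y. y \<in> sphere 0 1 \<Longrightarrow> N z \<le> N y"
    using continuous_attains_inf[of "sphere (0::'a) 1" N] by auto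
  have zp: "N z > 0" using z(1) N(1)[of z] N(2)[of z] by (cases "z = 0") auto
  have lo: "norm x \<le> (1 / N z) * N x" for x
  proof (cases "x = 0")
    case False
    then have "N z \<le> N ((1 / norm x) *\<^sub>R x)" by (intro z) simp
    also have "\<dots> = N x / norm x" using N(3) by simp
    finally show ?thesis using False zp by (simp add: field_simps)
  qed (use N in simp)
  show ?thesis using that[OF a _ up lo] zp by simp
qed

text \<open>A supremum of reals is informative only for a set that is bounded above. Comparison with
  the Euclidean norm supplies the bound; then the vector is rescaled to \<open>N\<close>-length
  1.\<close>

lemma le_induced_norm:
  fixes N :: "real^'n \<Rightarrow> real"
  assumes "is_norm N"
  shows "N (M *v x) \<le> induced_norm N M * N x"
proof (cases "x = 0")
  case True
  moreover have "N 0 = 0" using assms unfolding is_norm_def by blast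
  ultimately show ?thesis by simp
next
  case False
  have N: "\<And>x. 0 \<le> N x" "\<And>x. N x = 0 \<longleftrightarrow> x = 0"  "\<And>a x. N (a *\<^sub>R x) = \<bar>a\<bar> * N x"
    using assms by (auto simp: is_norm_def)
  have Nx: "N x > 0" using N(1)[of x] N(2)[of x] False by simp
  obtain a b where ab: "a > 0" "b > 0" "\<And>x. N x \<le> a * norm x" "\<And>x. norm x \<le> b * N x"
    using is_norm_equivalent[OF assms] by metis
  have "bdd_above ((\<lambda>x. N (M *v x)) ` {x. N x = 1})"
  proof (rule bdd_aboveI2)
    fix x assume "x \<in> {x. N x = 1}"
    then have "norm x \<le> b" using ab(4)[of x] by simp
    have "N (M *v x) \<le> a * norm (M *v x)" by (rule ab)
    also have "\<dots> \<le> a * (onorm ((*v) M) * norm x)"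
      using ab(1) by (intro mult_left_mono onorm) auto
    also have "\<dots> \<le> a * (onorm ((*v) M) * b)"
      using ab(1) \<open>norm x \<le> b\<close> by (intro mult_left_mono onorm_pos_le) auto
    finally show "N (M *v x) \<le> a * (onorm ((*v) M) * b)" .
  qed
  moreover have "N ((1 / N x) *\<^sub>R x) = 1" using Nx N(3) by simp
  ultimately have "N (M *v ((1 / N x) *\<^sub>R x)) \<le> induced_norm N M"
    unfolding induced_norm_def by (intro cSUP_upper) auto
  then have "N (M *v x) / N x \<le> induced_norm N M"
    using Nx N(3) by (simp add: matrix_vector_mult_scaleR)
  then show ?thesis using Nx by (simp add: field_simps)
qed

lemma bounded_bilinear_matrix_vector_mult:
  "bounded_bilinear ((*v) :: real^'n^'m \<Rightarrow> real^'n \<Rightarrow> real^'m)"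
proof -
  have "bilinear ((*v) :: real^'n^'m \<Rightarrow> real^'n \<Rightarrow> real^'m)"
    unfolding bilinear_def
    by (auto intro!: linearI simp: matrix_vector_right_distrib matrix_vector_mult_add_rdistrib
        matrix_vector_mult_scaleR scaleR_matrix_vector_assoc)
  then show ?thesis by (simp add: bilinear_conv_bounded_bilinear)
qed

lemma matrix_function_bound:
  fixes A :: "real \<Rightarrow> real^'n^'m"
  assumes "continuous_on {a..b} A"
  obtains K where "K > 0" "\<And>t v. t \<in> {a..b} \<Longrightarrow> norm (A t *v v) \<le> K * norm v"
proof -
  interpret bounded_bilinear "(*v) :: real^'n^'m \<Rightarrow> real^'n \<Rightarrow> real^'m"
    by (rule bounded_bilinear_matrix_vector_mult)
  obtain L where L: "L > 0" "\<And>(M::real^'n^'m) v. norm (M *v v) \<le> norm M * norm v * L"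
    using pos_bounded by blast
  have "bounded (A ` {a..b})" using assms by (intro compact_imp_bounded compact_continuous_image) auto
  then obtain B where B: "B > 0" "\<And>t. t \<in> {a..b} \<Longrightarrow> norm (A t) \<le> B"
    using bounded_pos[of "A ` {a..b}"] by auto
  have "norm (A t *v v) \<le> (B * L) * norm v" if "t \<in> {a..b}" for t v
  proof -
    have "norm (A t *v v) \<le> norm (A t) * norm v * L" by (rule L)
    also have "\<dots> \<le> B * norm v * L" using B that L(1) by (intro mult_right_mono) auto
    finally show ?thesis by (simp add: mult_ac)
  qed
  then show ?thesis using that[of "B * L"] B(1) L(1) by simp
qed

text \<open>Energy argument: if \<open>K\<close> bounds \<open>A\<close> on the interval,
  \<open>exp (- 2 * K * \<tau>)\<close> times the squared norm of \<open>y \<tau>\<close> has a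
  nonpositive derivative by Cauchy-Schwarz, and it starts at 0.\<close>

lemma linear_ode_zero_unique:
  fixes y :: "real \<Rightarrow> real^'n"
  assumes A: "continuous_on {s..t} A" and "s \<le> t"
    and der: "\<And>\<tau>. \<tau> \<in> {s..t} \<Longrightarrow> (y has_vector_derivative A \<tau> *v y \<tau>) (at \<tau> within {s..t})"
    and "y s = 0"
  shows "y t = 0"
proof (cases "s = t")
  case False
  then have "s < t" using \<open>s \<le> t\<close> by simp
  obtain K where K: "K > 0" "\<And>\<tau> v. \<tau> \<in> {s..t} \<Longrightarrow> norm (A \<tau> *v v) \<le> K * norm v"
    using matrix_function_bound[OF A] by metis
  define q where "q \<tau> = exp (- 2 * K * \<tau>) * (y \<tau> \<bullet> y \<tau>)" for \<tau>
  define q' where "q' \<tau> = exp (- 2 * K * \<tau>) * (2 * (y \<tau> \<bullet> (A \<tau> *v y \<tau>)) - 2 * K * (y \<tau> \<bullet> y \<tau>))" for \<tau>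
  have "(q has_derivative (\<lambda>h. h * q' \<tau>)) (at \<tau> within {s..t})" if "\<tau> \<in> {s..t}" for \<tau>
    unfolding q_def
    apply (rule derivative_eq_intros has_derivative_inner der[OF that, unfolded has_vector_derivative_def] refl)+
    apply (simp add: fun_eq_iff q'_def inner_commute algebra_simps)
    done
  then obtain \<xi> where \<xi>: "\<xi> \<in> {s<..<t}" "q t - q s = (t - s) * q' \<xi>"
    using mvt_simple[OF \<open>s < t\<close>, of q "\<lambda>\<tau> h. h * q' \<tau>"] by auto
  have "y \<xi> \<bullet> (A \<xi> *v y \<xi>) \<le> norm (y \<xi>) * norm (A \<xi> *v y \<xi>)" by (rule norm_cauchy_schwarz)
  also have "\<dots> \<le> norm (y \<xi>) * (K * norm (y \<xi>))" using K \<xi>(1) by (intro mult_left_mono) auto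
  also have "\<dots> = K * (y \<xi> \<bullet> y \<xi>)" by (simp add: dot_square_norm power2_eq_square)
  finally have "q' \<xi> \<le> 0" unfolding q'_def by (intro mult_nonneg_nonpos) auto
  then have "q t \<le> q s" using \<xi>(2) \<open>s < t\<close> by (smt (verit) mult_nonneg_nonpos)
  also have "q s = 0" by (simp add: q_def \<open>y s = 0\<close>)
  finally have "y t \<bullet> y t \<le> 0" by (simp add: q_def mult_le_0_iff)
  then show ?thesis by (metis inner_ge_zero inner_eq_zero_iff order_antisym)
qed (use \<open>y s = 0\<close> in simp)

lemma state_transition_matrix_apply_derivative:
  fixes A :: "real \<Rightarrow> real^'n^'n"
  assumes "state_transition_matrix A R" "0 \<le> s" "0 \<le> t"
  shows "((\<lambda>\<tau>. R \<tau> s *v v) has_vector_derivative A t *v (R t s *v v)) (at t within {0..})"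
proof -
  have "((\<lambda>\<tau>. R \<tau> s) has_vector_derivative A t ** R t s) (at t within {0..})"
    using assms unfolding state_transition_matrix_def by blast
  from bounded_linear.has_vector_derivative[OF
      bounded_bilinear.bounded_linear_left[OF bounded_bilinear_matrix_vector_mult] this, of v]
  show ?thesis by (simp add: matrix_vector_mul_assoc)
qed

text \<open>As functions of the final time, both sides solve the nominal equation from time
  \<open>s\<close> on and agree at \<open>s\<close>, so their difference is the zero
  solution.\<close>

lemma state_transition_matrix_cocycle:
  fixes A :: "real \<Rightarrow> real^'n^'n"
  assumes R: "state_transition_matrix A R" and A: "continuous_on {0..} A"
    and "0 \<le> r" "r \<le> s" "s \<le> t"
  shows "R t s *v (R s r *v v) = R t r *v v"
proof -
  define y where "y \<tau> = R \<tau> s *v (R s r *v v) - R \<tau> r *v v" for \<tau>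
  have "y t = 0"
  proof (rule linear_ode_zero_unique[OF _ \<open>s \<le> t\<close>])
    show "continuous_on {s..t} A" using A by (rule continuous_on_subset) (use assms in auto)
    show "y s = 0" using R assms by (simp add: y_def state_transition_matrix_def)
    fix \<tau> assume "\<tau> \<in> {s..t}"
    then have "(y has_vector_derivative A \<tau> *v (R \<tau> s *v (R s r *v v)) - A \<tau> *v (R \<tau> r *v v)) (at \<tau> within {0..})"
      unfolding y_def using assms
      by (intro has_vector_derivative_diff state_transition_matrix_apply_derivative[OF R]) auto
    then have "(y has_vector_derivative A \<tau> *v y \<tau>) (at \<tau> within {0..})"
      by (simp add: y_def matrix_vector_mult_diff_distrib)
    then show "(y has_vector_derivative A \<tau> *v y \<tau>) (at \<tau> within {s..t})"
      by (rule has_vector_derivative_within_subset) (use assms in auto)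
  qed
  then show ?thesis by (simp add: y_def)
qed

section \<open>The adapted norm and the Gronwall estimate\<close>

text \<open>
  Replaces differentiation of an absolutely continuous function: \<open>D\<close> has to decrease only up to an
  arbitrarily small fraction of the increment of \<open>M\<close>.
\<close>

lemma uniform_step_nonincreasing:
  fixes D M :: "real \<Rightarrow> real"
  assumes "a \<le> b"
    and step: "\<And>\<eta>. \<eta> > 0 \<Longrightarrow> \<exists>d>0. \<forall>s t. a \<le> s \<longrightarrow> s \<le> t \<longrightarrow> t \<le> b \<longrightarrow> t - s < d \<longrightarrow>
                 D t - D s \<le> \<eta> * (M t - M s)"
  shows "D b \<le> D a"
proof (rule field_le_epsilon)
  fix e :: real assume "e > 0"
  \<comment> \<open>The summand 1 keeps the denominator positive; the total increment of
    \<open>M\<close> times \<eta> is then at most \<open>e\<close>.\<close>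
  define \<eta> where "\<eta> = e / (\<bar>M b - M a\<bar> + 1)"
  have \<eta>: "\<eta> > 0" using \<open>e > 0\<close> by (simp add: \<eta>_def)
  \<comment> \<open>The guards are part of \<open>P\<close> because the bisection principle also
    tests intervals that stick out of \<open>{a..b}\<close>.\<close>
  define P where "P s t \<longleftrightarrow> (a \<le> s \<and> t \<le> b \<and> s \<le> t \<longrightarrow> D t - D s \<le> \<eta> * (M t - M s))" for s t
  obtain d where d: "d > 0" "\<And>s t. a \<le> s \<Longrightarrow> s \<le> t \<Longrightarrow> t \<le> b \<Longrightarrow> t - s < d \<Longrightarrow>
                 D t - D s \<le> \<eta> * (M t - M s)"
    using step[OF \<eta>] by blast
  have "P a b"
    using \<open>a \<le> b\<close>
  proof (induction rule: Bolzano)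
    case (trans u v w)
    show ?case unfolding P_def
    proof
      assume "a \<le> u \<and> w \<le> b \<and> u \<le> w"
      then have "D v - D u \<le> \<eta> * (M v - M u)" "D w - D v \<le> \<eta> * (M w - M v)"
        using trans by (auto simp: P_def)
      then show "D w - D u \<le> \<eta> * (M w - M u)" by (simp add: algebra_simps)
    qed
  next
    case (local x)
    then show ?case using d by (intro exI[of _ d]) (auto simp: P_def)
  qed
  then have "D b - D a \<le> \<eta> * (M b - M a)" using \<open>a \<le> b\<close> by (simp add: P_def)
  also have "\<dots> \<le> \<eta> * (\<bar>M b - M a\<bar> + 1)" using \<eta> by (intro mult_left_mono) auto
  also have "\<dots> = e" by (simp add: \<eta>_def add_nonneg_pos)
  finally show "D b \<le> D a + e" by simp
qed

section \<open>The adapted norm of a decaying linear flow\<close>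

locale decaying_linear_flow =
  fixes A :: "real \<Rightarrow> real^'n^'n" and R :: "real \<Rightarrow> real \<Rightarrow> real^'n^'n" and c \<gamma> :: real
  assumes A: "continuous_on {0..} A"
    and R: "state_transition_matrix A R"
    and c: "c > 0" and \<gamma>: "\<gamma> > 0"
    and decay: "0 \<le> s \<Longrightarrow> s \<le> t \<Longrightarrow> norm (R t s *v v) \<le> c * exp (- \<gamma> * (t - s)) * norm v"
begin

definition lyap :: "real \<Rightarrow> real^'n \<Rightarrow> real" where
  "lyap s v = (SUP t\<in>{s..}. exp (\<gamma> * (t - s)) * norm (R t s *v v))"

lemma R_refl: "0 \<le> s \<Longrightarrow> R s s *v v = v"
  using R by (simp add: state_transition_matrix_def)

text \<open>The weight undoes the decay, so the family under the supremum in \<open>lyap\<close> is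
  bounded over all \<open>t \<ge> s\<close>, and \<open>c\<close> becomes the upper comparison
  constant between \<open>lyap\<close> and the norm.\<close>

lemma weighted_flow_le:
  assumes "0 \<le> s" "s \<le> t"
  shows "exp (\<gamma> * (t - s)) * norm (R t s *v v) \<le> c * norm v"
proof -
  have "exp (\<gamma> * (t - s)) * norm (R t s *v v) \<le>
        exp (\<gamma> * (t - s)) * (c * exp (- \<gamma> * (t - s)) * norm v)"
    using decay[OF assms] by (intro mult_left_mono) auto
  also have "\<dots> = (exp (\<gamma> * (t - s)) * exp (- (\<gamma> * (t - s)))) * (c * norm v)" by simp
  also have "\<dots> = c * norm v" by (simp add: mult_exp_exp)
  finally show ?thesis .
qed

lemma flow_le_lyap:
  assumes "0 \<le> s" "s \<le> t"
  shows "exp (\<gamma> * (t - s)) * norm (R t s *v v) \<le> lyap s v"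
  unfolding lyap_def
  by (rule cSUP_upper) (use assms weighted_flow_le in \<open>auto intro!: bdd_aboveI2\<close>)

lemma norm_le_lyap: "0 \<le> s \<Longrightarrow> norm v \<le> lyap s v"
  using flow_le_lyap[of s s v] by (simp add: R_refl)

lemma lyap_le:
  assumes "0 \<le> s" "\<And>t. s \<le> t \<Longrightarrow> exp (\<gamma> * (t - s)) * norm (R t s *v v) \<le> B"
  shows "lyap s v \<le> B"
  unfolding lyap_def by (rule cSUP_least) (use assms in auto)

lemma lyap_le_norm: "0 \<le> s \<Longrightarrow> lyap s v \<le> c * norm v"
  by (rule lyap_le) (auto intro: weighted_flow_le)

lemma lyap_triangle:
  assumes "0 \<le> s"
  shows "lyap s (v + w) \<le> lyap s v + lyap s w"
proof (rule lyap_le[OF assms])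
  fix t assume "s \<le> t"
  have "exp (\<gamma> * (t - s)) * norm (R t s *v (v + w))
      \<le> exp (\<gamma> * (t - s)) * (norm (R t s *v v) + norm (R t s *v w))"
    by (intro mult_left_mono) (auto simp: matrix_vector_right_distrib norm_triangle_ineq)
  also have "\<dots> = exp (\<gamma> * (t - s)) * norm (R t s *v v) + exp (\<gamma> * (t - s)) * norm (R t s *v w)"
    by (simp add: algebra_simps)
  also have "\<dots> \<le> lyap s v + lyap s w"
    using flow_le_lyap[OF assms \<open>s \<le> t\<close>] by (intro add_mono) auto
  finally show "exp (\<gamma> * (t - s)) * norm (R t s *v (v + w)) \<le> lyap s v + lyap s w" .
qed

text \<open>By the cocycle law the supremum on the left runs over the same trajectory from time
  \<open>t\<close> on, and moving the base of the weight from \<open>s\<close> to \<open>t\<close>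
  produces the exponential. No constant stands in front, so the estimate can be iterated over many
  short steps without loss.\<close>

lemma lyap_flow_le:
  assumes "0 \<le> s" "s \<le> t"
  shows "lyap t (R t s *v v) \<le> exp (- \<gamma> * (t - s)) * lyap s v"
proof (rule lyap_le)
  fix \<tau> assume "t \<le> \<tau>"
  have "exp (\<gamma> * (\<tau> - t)) * norm (R \<tau> t *v (R t s *v v)) =
        exp (- \<gamma> * (t - s)) * (exp (\<gamma> * (\<tau> - s)) * norm (R \<tau> s *v v))"
    using state_transition_matrix_cocycle[OF R A assms \<open>t \<le> \<tau>\<close>]
    by (simp add: mult_exp_exp flip: mult.assoc) (simp add: algebra_simps)
  also have "\<dots> \<le> exp (- \<gamma> * (t - s)) * lyap s v"
    using assms \<open>t \<le> \<tau>\<close> by (intro mult_left_mono flow_le_lyap) auto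
  finally show "exp (\<gamma> * (\<tau> - t)) * norm (R \<tau> t *v (R t s *v v)) \<le> exp (- \<gamma> * (t - s)) * lyap s v" .
qed (use assms in simp)

text \<open>The decay estimate keeps the flow below \<open>c * norm v\<close>, so its velocity is
  bounded and the displacement is of first order in \<open>t - s\<close>. Integrated once more
  against \<open>A\<close> it becomes a second order term.\<close>

lemma flow_displacement:
  assumes "0 \<le> s" "s \<le> t"
    and K: "\<And>\<tau> v. \<tau> \<in> {s..t} \<Longrightarrow> norm (A \<tau> *v v) \<le> K * norm v" and "K > 0"
  shows "((\<lambda>\<tau>. A \<tau> *v (R \<tau> s *v v)) has_integral (R t s *v v - v)) {s..t}"
    and "norm (R t s *v v - v) \<le> K * c * norm v * (t - s)"
proof -
  have int: "((\<lambda>\<tau>. A \<tau> *v (R \<tau> s *v v)) has_integral (R t s *v v - R s s *v v)) {s..t}"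
    by (intro fundamental_theorem_of_calculus)
      (use assms in \<open>auto intro!: has_vector_derivative_within_subset[OF state_transition_matrix_apply_derivative[OF R]]\<close>)
  then show 1: "((\<lambda>\<tau>. A \<tau> *v (R \<tau> s *v v)) has_integral (R t s *v v - v)) {s..t}"
    using assms by (simp add: R_refl)
  have "norm (A \<tau> *v (R \<tau> s *v v)) \<le> K * c * norm v" if "\<tau> \<in> {s..t}" for \<tau>
  proof -
    have "norm (A \<tau> *v (R \<tau> s *v v)) \<le> K * norm (R \<tau> s *v v)" using K that by simp
    also have "\<dots> \<le> K * (c * exp (- \<gamma> * (\<tau> - s)) * norm v)"
      using that assms by (intro mult_left_mono decay) auto
    also have "\<dots> \<le> K * (c * 1 * norm v)"
      using that assms c \<gamma> by (intro mult_left_mono mult_right_mono) auto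
    finally show ?thesis by simp
  qed
  then show "norm (R t s *v v - v) \<le> K * c * norm v * (t - s)"
    using has_integral_bound[OF _ 1[folded box_real(2)], of "K * c * norm v"] assms c
    by simp
qed

end

text \<open>The right side times \<open>1 + y\<close> equals \<open>1 + y^3\<close>, and
  \<open>exp y\<close> is at least \<open>1 + y\<close>. In a single time step this separates the
  linear term, which is to cancel, from a second order remainder.\<close>

lemma exp_neg_le_quadratic:
  fixes y :: real
  assumes "0 \<le> y"
  shows "exp (- y) \<le> 1 - y + y\<^sup>2"
proof -
  have "1 \<le> (1 + y) * (1 - y + y\<^sup>2)"
    using assms by (simp add: algebra_simps power2_eq_square power3_eq_cube)
  then have "1 / (1 + y) \<le> 1 - y + y\<^sup>2" using assms by (simp add: field_simps)
  moreover have "exp (- y) \<le> 1 / (1 + y)"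
    using assms exp_ge_add_one_self[of y] by (simp add: exp_minus inverse_eq_divide frac_le)
  ultimately show ?thesis by linarith
qed

text \<open>A continuous factor alone need not preserve gauge integrability; nonnegativity makes
  \<open>h\<close> absolutely integrable, and then a bounded measurable factor is harmless.\<close>

lemma integrable_continuous_mult_nonneg:
  fixes E h :: "real \<Rightarrow> real"
  assumes "continuous_on {a..b} E" "h integrable_on {a..b}" "\<And>s. s \<in> {a..b} \<Longrightarrow> 0 \<le> h s"
  shows "(\<lambda>s. E s * h s) integrable_on {a..b}"
proof -
  have "(\<lambda>s. E s * h s) absolutely_integrable_on {a..b}"
  proof (rule absolutely_integrable_bounded_measurable_product_real)
    show "E \<in> borel_measurable (lebesgue_on {a..b})"
      using assms(1) by (rule continuous_imp_measurable_on_sets_lebesgue) simp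
    show "bounded (E ` {a..b})"
      using assms(1) by (intro compact_imp_bounded compact_continuous_image) auto
    show "h absolutely_integrable_on {a..b}"
      using assms by (intro nonnegative_absolutely_integrable_1) auto
  qed simp
  then show ?thesis by (simp add: absolutely_integrable_on_def)
qed

lemma uniform_modulus:
  fixes f :: "real \<Rightarrow> 'b::metric_space"
  assumes "continuous_on {a..b} f" "e > 0"
  obtains d where "d > 0" "\<And>s t. a \<le> s \<Longrightarrow> s \<le> t \<Longrightarrow> t \<le> b \<Longrightarrow> t - s < d \<Longrightarrow> dist (f t) (f s) < e"
proof -
  have "uniformly_continuous_on {a..b} f"
    using assms by (intro compact_uniformly_continuous) auto
  then obtain d where d: "d > 0"
    "\<And>x x'. x\<in>{a..b} \<Longrightarrow> x'\<in>{a..b} \<Longrightarrow> dist x' x < d \<Longrightarrow> dist (f x') (f x) < e"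
    using assms(2) unfolding uniformly_continuous_on_def by blast
  show ?thesis
    by (rule that[OF d(1)], rule d(2)) (auto simp: dist_real_def)
qed

section \<open>One time step along a perturbed solution, and the Gronwall estimate\<close>

context decaying_linear_flow
begin

text \<open>Solution and flow leave the same point \<open>x s\<close>, so their difference at
  \<open>t\<close> is the integral of \<open>f\<close> plus the integral of \<open>A\<close> applied
  to the difference itself. For the second integral a crude bound is enough, \<eta> plus the
  displacement of the flow, since the length \<open>t - s\<close> of the step multiplies it.\<close>

lemma flow_deviation:
  assumes "0 \<le> s" "s \<le> t"
    and x: "continuous_on {s..t} x" and f: "f integrable_on {s..t}"
    and eq: "\<And>\<tau>. \<tau> \<in> {s..t} \<Longrightarrow> x \<tau> = x s + integral {s..\<tau>} (\<lambda>u. A u *v x u + f u)"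
    and fb: "\<And>\<tau>. \<tau> \<in> {s..t} \<Longrightarrow> norm (f \<tau>) \<le> k \<tau>" and k: "k integrable_on {s..t}"
    and K: "\<And>\<tau> v. \<tau> \<in> {s..t} \<Longrightarrow> norm (A \<tau> *v v) \<le> K * norm v" "K > 0"
    and \<eta>: "\<And>\<tau>. \<tau> \<in> {s..t} \<Longrightarrow> norm (x \<tau> - x s) \<le> \<eta>"
  shows "norm (x t - R t s *v x s) \<le> integral {s..t} k + K * (\<eta> + K * c * norm (x s) * (t - s)) * (t - s)"
proof -
  have A': "continuous_on {s..t} A" using A by (rule continuous_on_subset) (use \<open>0 \<le> s\<close> in auto)
  have Ax: "(\<lambda>u. A u *v x u) integrable_on {s..t}"
    by (intro integrable_continuous_real bounded_bilinear.continuous_on[OF bounded_bilinear_matrix_vector_mult] A' x)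
  note fd = flow_displacement[OF \<open>0 \<le> s\<close> \<open>s \<le> t\<close> K]
  have "((\<lambda>u. A u *v x u) has_integral integral {s..t} (\<lambda>u. A u *v x u)) {s..t}"
    using Ax by (simp add: integrable_integral)
  from has_integral_diff[OF this fd(1)[of "x s"]]
  have dev: "((\<lambda>u. A u *v (x u - R u s *v x s)) has_integral
      (integral {s..t} (\<lambda>u. A u *v x u) - (R t s *v x s - x s))) {s..t}"
    by (simp add: matrix_vector_mult_diff_distrib)
  have bound: "norm (A u *v (x u - R u s *v x s)) \<le> K * (\<eta> + K * c * norm (x s) * (t - s))"
    if u: "u \<in> {s..t}" for u
  proof -
    have "norm (R u s *v x s - x s) \<le> K * c * norm (x s) * (u - s)"
      by (rule flow_displacement(2)) (use u \<open>0 \<le> s\<close> K in auto)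
    also have "\<dots> \<le> K * c * norm (x s) * (t - s)"
      using u K(2) c by (intro mult_left_mono) auto
    finally have "norm (x u - R u s *v x s) \<le> \<eta> + K * c * norm (x s) * (t - s)"
      using \<eta>[OF u] norm_triangle_ineq4[of "x u - x s" "R u s *v x s - x s"] by simp
    then show ?thesis using K(1)[OF u, of "x u - R u s *v x s"] K(2)
      by (smt (verit) mult_left_mono)
  qed
  have "\<eta> \<ge> 0" using \<eta>[of s] \<open>s \<le> t\<close> by simp
  then have n1: "norm (integral {s..t} (\<lambda>u. A u *v x u) - (R t s *v x s - x s))
      \<le> K * (\<eta> + K * c * norm (x s) * (t - s)) * (t - s)"
    using has_integral_bound[OF _ dev[folded box_real(2)], of "K * (\<eta> + K * c * norm (x s) * (t - s))"]
      bound \<open>s \<le> t\<close> K(2) c by simp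
  have n2: "norm (integral {s..t} f) \<le> integral {s..t} k"
    using f k fb by (intro integral_norm_bound_integral) auto
  have "x t = x s + (integral {s..t} (\<lambda>u. A u *v x u) + integral {s..t} f)"
    using eq[of t] \<open>s \<le> t\<close> integral_add[OF Ax f] by simp
  then have "x t - R t s *v x s = integral {s..t} f + (integral {s..t} (\<lambda>u. A u *v x u) - (R t s *v x s - x s))"
    by simp
  then show ?thesis using n1 n2 norm_triangle_ineq by (smt (verit))
qed

text \<open>The algebra of one Gronwall step: \<beta> and \<theta> stand for the integrals of the
  linear coefficient and of the inhomogeneity over the step, \<open>E\<close> and \<open>E'\<close>
  for the weight at its two ends. In \<open>E'\<close> the factor
  \<open>exp (\<gamma> * (t - s))\<close> cancels the contraction of the flow, and
  \<open>exp (- c * \<beta>)\<close> cancels the growth caused by \<beta> to first order. Apart from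
  \<open>c * I\<close>, what is left is \<eta> times the size of the step.\<close>

lemma lyap_step:
  assumes "0 \<le> s" "0 \<le> t" "s \<le> t"
    and dev: "norm (y - R t s *v v) \<le> \<beta> * (norm v + \<eta>) + \<theta> + J * \<eta> * (t - s)"
    and pos: "\<beta> \<ge> 0" "\<theta> \<ge> 0" "J \<ge> 0" "\<eta> \<ge> 0" and "\<eta> \<le> 1" "\<beta> \<le> \<eta>"
    and E: "0 < E" "E \<le> Em" "0 < E'" "E' \<le> Em" "E' \<le> E + \<eta>" "E' = E * exp (\<gamma> * (t - s) - c * \<beta>)"
    and W: "lyap s v \<le> Wm" and Eh: "E' * \<theta> \<le> I + \<eta> * \<theta>"
  shows "E' * lyap t y - E * lyap s v \<le>
    c * I + \<eta> * (c\<^sup>2 * Em * Wm + c * (Em + Wm + 1) + c + c * Em * J) * (\<beta> + \<theta> + (t - s))"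
proof -
  define W where "W = lyap s v"
  have vW: "norm v \<le> W" unfolding W_def by (rule norm_le_lyap) fact
  then have W0: "W \<ge> 0" "W \<le> Wm" using W norm_ge_zero[of v] by (auto simp: W_def simp del: norm_ge_zero)
  have "lyap t y \<le> lyap t (R t s *v v) + lyap t (y - R t s *v v)"
    using lyap_triangle[OF \<open>0 \<le> t\<close>, of "R t s *v v" "y - R t s *v v"] by simp
  also have "\<dots> \<le> exp (- \<gamma> * (t - s)) * W + c * (\<beta> * (norm v + \<eta>) + \<theta> + J * \<eta> * (t - s))"
    unfolding W_def using lyap_flow_le[OF \<open>0 \<le> s\<close> \<open>s \<le> t\<close>, of v] lyap_le_norm[OF \<open>0 \<le> t\<close>, of "y - R t s *v v"] dev c
    by (smt (verit) mult_left_mono)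
  also have "\<dots> \<le> exp (- \<gamma> * (t - s)) * W + c * (\<beta> * (W + \<eta>) + \<theta> + J * \<eta> * (t - s))"
    using vW c pos by (intro add_left_mono mult_left_mono add_right_mono) auto
  finally have "E' * lyap t y \<le> E' * (exp (- \<gamma> * (t - s)) * W + c * (\<beta> * (W + \<eta>) + \<theta> + J * \<eta> * (t - s)))"
    using E by (intro mult_left_mono) auto
  \<comment> \<open>Only the contracted term is rewritten in terms of \<open>E\<close>; the other
    occurrences of \<open>E'\<close> are compared with \<open>E + \<eta>\<close> or
    \<open>Em\<close> below.\<close>
  also have "\<dots> = E * exp (- (c * \<beta>)) * W + c * (E' * (\<beta> * (W + \<eta>))) + c * (E' * \<theta>) + c * (E' * (J * \<eta> * (t - s)))"
    unfolding E(6) by (simp add: algebra_simps exp_diff exp_minus) (simp add: field_simps flip: exp_add)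
  finally have main: "E' * lyap t y \<le> E * exp (- (c * \<beta>)) * W + c * (E' * (\<beta> * (W + \<eta>))) + c * (E' * \<theta>) + c * (E' * (J * \<eta> * (t - s)))" .
  \<comment> \<open>In the quadratic remainder one factor \<beta> is traded for \<eta>.\<close>
  have "exp (- (c * \<beta>)) \<le> 1 - c * \<beta> + (c * \<beta>)\<^sup>2"
    using c pos by (intro exp_neg_le_quadratic) auto
  also have "(c * \<beta>)\<^sup>2 \<le> c\<^sup>2 * \<eta> * \<beta>"
    using c pos \<open>\<beta> \<le> \<eta>\<close> by (simp add: power2_eq_square mult_mono mult.commute mult.left_commute)
  finally have "E * W * exp (- (c * \<beta>)) \<le> E * W * (1 - c * \<beta> + c\<^sup>2 * \<eta> * \<beta>)"
    using E W0 by (intro mult_left_mono) auto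
  also have "\<dots> = E * W - c * (E * \<beta> * W) + (E * W) * (c\<^sup>2 * \<eta> * \<beta>)" by (simp add: algebra_simps)
  also have "\<dots> \<le> E * W - c * (E * \<beta> * W) + (Em * Wm) * (c\<^sup>2 * \<eta> * \<beta>)"
    using E W0 pos by (intro add_left_mono mult_right_mono mult_mono) auto
  finally have t1: "E * exp (- (c * \<beta>)) * W \<le> E * W - c * (E * \<beta> * W) + (Em * Wm) * (c\<^sup>2 * \<eta> * \<beta>)"
    by (simp add: mult_ac)
  \<comment> \<open>Passing from \<open>E'\<close> to \<open>E\<close> isolates
    \<open>E * \<beta> * W\<close>, which \<open>t1\<close> contains with the opposite sign.\<close>
  have "E' * (\<beta> * (W + \<eta>)) \<le> (E + \<eta>) * (\<beta> * (W + \<eta>))"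
    using E W0 pos by (intro mult_right_mono) auto
  also have "\<dots> = E * \<beta> * W + \<eta> * \<beta> * (E + W + \<eta>)" by (simp add: algebra_simps)
  also have "\<dots> \<le> E * \<beta> * W + \<eta> * \<beta> * (Em + Wm + 1)"
    using E W0 pos \<open>\<eta> \<le> 1\<close> by (intro add_left_mono mult_left_mono) auto
  finally have t2: "c * (E' * (\<beta> * (W + \<eta>))) \<le> c * (E * \<beta> * W + \<eta> * \<beta> * (Em + Wm + 1))"
    using c by simp
  have t3: "c * (E' * \<theta>) \<le> c * (I + \<eta> * \<theta>)" using Eh c by simp
  have t4: "c * (E' * (J * \<eta> * (t - s))) \<le> c * (Em * (J * \<eta> * (t - s)))"
    using c E pos \<open>s \<le> t\<close> by (intro mult_left_mono mult_right_mono) auto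
  have Em: "Em > 0" using E by linarith
  let ?a = "c\<^sup>2 * Em * Wm + c * (Em + Wm + 1)" and ?b = c and ?d = "c * Em * J"
  have abd: "?a \<ge> 0" "?b \<ge> 0" "?d \<ge> 0" using c Em W0 pos by auto
  have "E' * lyap t y - E * W \<le> c * I + \<eta> * (?a * \<beta> + ?b * \<theta> + ?d * (t - s))"
    using main t1 t2 t3 t4 by (simp add: algebra_simps)
  \<comment> \<open>The three coefficients are replaced by their sum, so that the remainder is a
    multiple of one increment, as \<open>uniform_step_nonincreasing\<close> requires.\<close>
  also have "\<dots> \<le> c * I + \<eta> * ((?a + ?b + ?d) * (\<beta> + \<theta> + (t - s)))"
  proof -
    have "u * \<beta> + v * \<theta> + w * (t - s) \<le> (u + v + w) * (\<beta> + \<theta> + (t - s))"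
      if "u \<ge> 0" "v \<ge> 0" "w \<ge> 0" for u v w :: real
    proof -
      have "(u + v + w) * (\<beta> + \<theta> + (t - s)) - (u * \<beta> + v * \<theta> + w * (t - s)) =
        u * \<theta> + u * (t - s) + (v * \<beta> + v * (t - s)) + (w * \<beta> + w * \<theta>)" by (simp add: algebra_simps)
      also have "\<dots> \<ge> 0" using that pos \<open>s \<le> t\<close> by simp
      finally show ?thesis by simp
    qed
    from this[OF abd] show ?thesis using pos by (intro add_left_mono mult_left_mono) auto
  qed
  also have "\<dots> = c * I + \<eta> * (?a + ?b + ?d) * (\<beta> + \<theta> + (t - s))" by (simp only: mult.assoc)
  finally show ?thesis by (simp add: W_def)
qed

text \<open>Gronwall in integrated form. The quantity \<open>D\<close>, the weighted adapted norm
  minus \<open>c\<close> times the accumulated weighted inhomogeneity, is shown to be nonincreasing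
  by summing short steps; with \<open>b\<close> and \<open>h\<close> merely integrable nothing is
  differentiated.\<close>

lemma perturbed_estimate:
  fixes x f :: "real \<Rightarrow> real^'n" and b h :: "real \<Rightarrow> real"
  assumes a: "0 \<le> a" "a \<le> T"
    and x: "continuous_on {a..T} x" and f: "f integrable_on {a..T}"
    and eq: "\<And>t. t \<in> {a..T} \<Longrightarrow> x t = x a + integral {a..t} (\<lambda>s. A s *v x s + f s)"
    and fb: "\<And>s. s \<in> {a..T} \<Longrightarrow> norm (f s) \<le> b s * norm (x s) + h s"
    and b: "b integrable_on {a..T}" "\<And>s. s \<in> {a..T} \<Longrightarrow> 0 \<le> b s"
    and h: "h integrable_on {a..T}" "\<And>s. s \<in> {a..T} \<Longrightarrow> 0 \<le> h s"
  defines "B \<equiv> \<lambda>t. integral {a..t} b"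
  defines "E \<equiv> \<lambda>t. exp (\<gamma> * t - c * B t)"
  shows "E T * norm (x T) \<le> c * E a * norm (x a) + c * integral {a..T} (\<lambda>s. E s * h s)"
proof -
  have A': "continuous_on {a..T} A" using A by (rule continuous_on_subset) (use a in auto)
  obtain K where K: "K > 0" "\<And>t v. t \<in> {a..T} \<Longrightarrow> norm (A t *v v) \<le> K * norm v"
    using matrix_function_bound[OF A'] by metis
  have "bounded (x ` {a..T})" using x by (intro compact_imp_bounded compact_continuous_image) auto
  then obtain X where X: "X > 0" "\<And>t. t \<in> {a..T} \<Longrightarrow> norm (x t) \<le> X"
    using bounded_pos[of "x ` {a..T}"] by auto
  have contB: "continuous_on {a..T} B"
    unfolding B_def by (rule indefinite_integral_continuous_1[OF b(1)])
  have contE: "continuous_on {a..T} E"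
    unfolding E_def by (intro continuous_intros contB)
  have "bounded (E ` {a..T})" using contE by (intro compact_imp_bounded compact_continuous_image) auto
  then obtain Em where Em: "Em > 0" "\<And>t. t \<in> {a..T} \<Longrightarrow> E t \<le> Em"
    using bounded_pos[of "E ` {a..T}"] by (auto simp: abs_le_iff)
  have Epos: "E t > 0" for t by (simp add: E_def)
  have Eh: "(\<lambda>s. E s * h s) integrable_on {a..T}"
    by (rule integrable_continuous_mult_nonneg[OF contE h])
  have Ax: "(\<lambda>u. A u *v x u) integrable_on {a..T}"
    by (intro integrable_continuous_real bounded_bilinear.continuous_on[OF bounded_bilinear_matrix_vector_mult] A' x)
  have split: "integral {a..t} \<psi> - integral {a..s} \<psi> = integral {s..t} \<psi>" "\<psi> integrable_on {s..t}"
    if "\<psi> integrable_on {a..T}" "a \<le> s" "s \<le> t" "t \<le> T" for s t and \<psi> :: "real \<Rightarrow> 'z::euclidean_space"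
  proof -
    have \<psi>: "\<psi> integrable_on {a..t}" using that by (intro integrable_subinterval_real[OF that(1)]) auto
    show "integral {a..t} \<psi> - integral {a..s} \<psi> = integral {s..t} \<psi>"
      using Henstock_Kurzweil_Integration.integral_combine[OF that(2,3) \<psi>] by (simp add: algebra_simps)
    show "\<psi> integrable_on {s..t}" using that by (intro integrable_subinterval_real[OF that(1)]) auto
  qed
  \<comment> \<open>\<open>J\<close> makes the second order term of \<open>flow_deviation\<close> at
    most \<open>J * \<eta> * (t - s)\<close> when \<open>t - s < \<eta>\<close>; \<open>L\<close> is
    the remainder coefficient of \<open>lyap_step\<close> for the bound \<open>c * X\<close> on
    \<open>lyap\<close> along the solution.\<close>
  define J where "J = K * (1 + K * c * X)"
  define L where "L = c\<^sup>2 * Em * (c * X) + c * (Em + c * X + 1) + c + c * Em * J"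
  have J: "J \<ge> 0" using K(1) c X(1) by (simp add: J_def)
  have L: "L > 0" unfolding L_def using c Em(1) X(1) J by (simp add: add_nonneg_pos add_pos_nonneg add_pos_pos)
  define D where "D t = E t * lyap t (x t) - c * integral {a..t} (\<lambda>s. E s * h s)" for t
  \<comment> \<open>The increment of \<open>M\<close> over \<open>{s..t}\<close> is exactly
    \<open>\<beta> + \<theta> + (t - s)\<close>.\<close>
  define M where "M t = B t + integral {a..t} h + t" for t
  have "D T \<le> D a"
  proof (rule uniform_step_nonincreasing[where D = D and M = M and a = a and b = T])
    fix \<epsilon> :: real assume "\<epsilon> > 0"
    define \<eta> where "\<eta> = min 1 (\<epsilon> / L)"
    have \<eta>: "\<eta> > 0" "\<eta> \<le> 1" "\<eta> * L \<le> \<epsilon>" using \<open>\<epsilon> > 0\<close> L by (auto simp: \<eta>_def min_def field_simps)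
    obtain d1 where d1: "d1 > 0" "\<And>s t. a \<le> s \<Longrightarrow> s \<le> t \<Longrightarrow> t \<le> T \<Longrightarrow> t - s < d1 \<Longrightarrow> dist (x t) (x s) < \<eta>"
      using uniform_modulus[OF x \<eta>(1)] by metis
    obtain d2 where d2: "d2 > 0" "\<And>s t. a \<le> s \<Longrightarrow> s \<le> t \<Longrightarrow> t \<le> T \<Longrightarrow> t - s < d2 \<Longrightarrow> dist (B t) (B s) < \<eta>"
      using uniform_modulus[OF contB \<eta>(1)] by metis
    obtain d3 where d3: "d3 > 0" "\<And>s t. a \<le> s \<Longrightarrow> s \<le> t \<Longrightarrow> t \<le> T \<Longrightarrow> t - s < d3 \<Longrightarrow> dist (E t) (E s) < \<eta>"
      using uniform_modulus[OF contE \<eta>(1)] by metis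
    \<comment> \<open>Three moduli of continuity, for \<open>x\<close>, \<open>B\<close> and
      \<open>E\<close>; the bound \<eta> on the step itself controls the displacement of the
      flow.\<close>
    define d where "d = min (min d1 d2) (min d3 \<eta>)"
    show "\<exists>d>0. \<forall>s t. a \<le> s \<longrightarrow> s \<le> t \<longrightarrow> t \<le> T \<longrightarrow> t - s < d \<longrightarrow> D t - D s \<le> \<epsilon> * (M t - M s)"
    proof (intro exI[of _ d] conjI allI impI)
      show "d > 0" using d1 d2 d3 \<eta> by (simp add: d_def)
      fix s t assume st: "a \<le> s" "s \<le> t" "t \<le> T" "t - s < d"
      have sub: "u \<in> {a..T}" if "u \<in> {s..t}" for u using that st by auto
      define \<beta> where "\<beta> = integral {s..t} b"
      define \<theta> where "\<theta> = integral {s..t} h"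
      have \<beta>: "B t - B s = \<beta>" "b integrable_on {s..t}" "\<beta> \<ge> 0"
        using split[OF b(1) st(1-3)] b(2) sub unfolding \<beta>_def B_def by (auto intro: integral_nonneg)
      have \<theta>: "integral {a..t} h - integral {a..s} h = \<theta>" "h integrable_on {s..t}" "\<theta> \<ge> 0"
        using split[OF h(1) st(1-3)] h(2) sub unfolding \<theta>_def by (auto intro: integral_nonneg)
      have "norm (x t - R t s *v x s) \<le> integral {s..t} (\<lambda>\<tau>. b \<tau> * (norm (x s) + \<eta>) + h \<tau>)
          + K * (\<eta> + K * c * norm (x s) * (t - s)) * (t - s)"
      proof (rule flow_deviation)
        show "continuous_on {s..t} x" using x by (rule continuous_on_subset) (use st in auto)
        show "f integrable_on {s..t}" by (rule split[OF f st(1-3)])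
        show "x \<tau> = x s + integral {s..\<tau>} (\<lambda>u. A u *v x u + f u)" if "\<tau> \<in> {s..t}" for \<tau>
          using eq[of \<tau>] eq[of s] split(1)[OF integrable_add[OF Ax f], of s \<tau>] that st
          by (simp add: algebra_simps)
        show "norm (f \<tau>) \<le> b \<tau> * (norm (x s) + \<eta>) + h \<tau>" if "\<tau> \<in> {s..t}" for \<tau>
        proof -
          have "dist (x \<tau>) (x s) < \<eta>" using that st by (intro d1) (auto simp: d_def)
          then have "norm (x \<tau>) \<le> norm (x s) + \<eta>"
            using norm_triangle_ineq2[of "x \<tau>" "x s"] by (simp add: dist_norm)
          then have "b \<tau> * norm (x \<tau>) \<le> b \<tau> * (norm (x s) + \<eta>)"
            using b(2) sub[OF that] by (intro mult_left_mono) auto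
          then show ?thesis using fb[OF sub[OF that]] by simp
        qed
        show "(\<lambda>\<tau>. b \<tau> * (norm (x s) + \<eta>) + h \<tau>) integrable_on {s..t}"
          using \<beta> \<theta> by (intro integrable_add integrable_on_mult_left) auto
        show "norm (x \<tau> - x s) \<le> \<eta>" if "\<tau> \<in> {s..t}" for \<tau>
          using d1(2)[of s \<tau>] that st by (simp add: d_def dist_norm)
      qed (use st a K sub in auto)
      also have "integral {s..t} (\<lambda>\<tau>. b \<tau> * (norm (x s) + \<eta>) + h \<tau>) = \<beta> * (norm (x s) + \<eta>) + \<theta>"
        using \<beta> \<theta> by (simp add: integral_add integrable_on_mult_left \<beta>_def \<theta>_def)
      also have "K * (\<eta> + K * c * norm (x s) * (t - s)) * (t - s) \<le> J * \<eta> * (t - s)"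
      proof -
        have "K * c * norm (x s) * (t - s) \<le> K * c * X * \<eta>"
          using K(1) c X sub[of s] st by (intro mult_mono) (auto simp: d_def)
        then have "K * (\<eta> + K * c * norm (x s) * (t - s)) \<le> K * (\<eta> + K * c * X * \<eta>)"
          using K(1) by simp
        also have "\<dots> = J * \<eta>" by (simp add: J_def algebra_simps)
        finally show ?thesis using st by (intro mult_right_mono) auto
      qed
      finally have dev: "norm (x t - R t s *v x s) \<le> \<beta> * (norm (x s) + \<eta>) + \<theta> + J * \<eta> * (t - s)"
        by simp
      have "E t * lyap t (x t) - E s * lyap s (x s) \<le>
          c * integral {s..t} (\<lambda>s. E s * h s) +
          \<eta> * (c\<^sup>2 * Em * (c * X) + c * (Em + c * X + 1) + c + c * Em * J) * (\<beta> + \<theta> + (t - s))"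
      proof (rule lyap_step[OF _ _ st(2) dev])
        show "\<beta> \<le> \<eta>" using d2(2)[OF st(1-3)] st(4) \<beta> by (simp add: d_def dist_real_def)
        show "E t \<le> E s + \<eta>" using d3(2)[OF st(1-3)] st(4) by (simp add: d_def dist_real_def)
        have "B t = B s + \<beta>" using \<beta>(1) by simp
        then show "E t = E s * exp (\<gamma> * (t - s) - c * \<beta>)"
          by (simp add: E_def mult_exp_exp algebra_simps)
        have "lyap s (x s) \<le> c * norm (x s)" using a st by (intro lyap_le_norm) auto
        also have "\<dots> \<le> c * X" using X sub[of s] st c by (intro mult_left_mono) auto
        finally show "lyap s (x s) \<le> c * X" .
        \<comment> \<open>The weight varies by less than \<eta> during the step, so freezing it at
          time \<open>t\<close> costs at most \<open>\<eta> * \<theta>\<close>.\<close>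
        have "E t * \<theta> = integral {s..t} (\<lambda>\<tau>. E t * h \<tau>)" by (simp add: \<theta>_def)
        also have "\<dots> \<le> integral {s..t} (\<lambda>\<tau>. E \<tau> * h \<tau> + \<eta> * h \<tau>)"
        proof (rule integral_le)
          fix \<tau> assume \<tau>: "\<tau> \<in> {s..t}"
          have "E t \<le> E \<tau> + \<eta>" using d3(2)[of \<tau> t] \<tau> st by (simp add: d_def dist_real_def)
          then show "E t * h \<tau> \<le> E \<tau> * h \<tau> + \<eta> * h \<tau>"
            using h(2)[OF sub[OF \<tau>]] by (metis distrib_right mult_right_mono)
        qed (use \<theta> split[OF Eh st(1-3)] in \<open>auto intro!: integrable_add integrable_on_mult_right\<close>)
        also have "\<dots> = integral {s..t} (\<lambda>\<tau>. E \<tau> * h \<tau>) + \<eta> * \<theta>"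
          using \<theta> split[OF Eh st(1-3)]
          by (subst integral_add) (auto intro!: integrable_on_mult_right simp: \<theta>_def)
        finally show "E t * \<theta> \<le> integral {s..t} (\<lambda>\<tau>. E \<tau> * h \<tau>) + \<eta> * \<theta>" .
      qed (use a st \<beta> \<theta> J \<eta> Epos Em in auto)
      also have "\<eta> * (c\<^sup>2 * Em * (c * X) + c * (Em + c * X + 1) + c + c * Em * J) * (\<beta> + \<theta> + (t - s))
          \<le> \<epsilon> * (\<beta> + \<theta> + (t - s))"
        using \<eta>(3) \<beta>(3) \<theta>(3) st(2) unfolding L_def by (intro mult_right_mono) auto
      finally have "E t * lyap t (x t) - E s * lyap s (x s) \<le>
          c * integral {s..t} (\<lambda>s. E s * h s) + \<epsilon> * (\<beta> + \<theta> + (t - s))" by simp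
      moreover have "integral {a..t} (\<lambda>s. E s * h s) - integral {a..s} (\<lambda>s. E s * h s) = integral {s..t} (\<lambda>s. E s * h s)"
        by (rule split[OF Eh st(1-3)])
      then have "c * integral {a..t} (\<lambda>s. E s * h s) - c * integral {a..s} (\<lambda>s. E s * h s) = c * integral {s..t} (\<lambda>s. E s * h s)"
        by (metis right_diff_distrib)
      ultimately have "D t - D s \<le> \<epsilon> * (\<beta> + \<theta> + (t - s))" unfolding D_def by linarith
      also have "\<beta> + \<theta> + (t - s) = M t - M s" using \<beta>(1) \<theta>(1) by (simp add: M_def)
      finally show "D t - D s \<le> \<epsilon> * (M t - M s)" .
    qed
  qed (rule a)
  \<comment> \<open>Return to the Euclidean norm: for the initial value the comparison constant
    \<open>c\<close> is paid once, not at every step.\<close>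
  moreover have "E T * norm (x T) \<le> E T * lyap T (x T)"
    using norm_le_lyap[of T "x T"] a Epos[of T] by (intro mult_left_mono) auto
  moreover have "E a * lyap a (x a) \<le> E a * (c * norm (x a))"
    using lyap_le_norm[of a "x a"] a Epos[of a] by (intro mult_left_mono) auto
  ultimately show ?thesis by (simp add: D_def mult_ac)
qed

end

section \<open>From the Gronwall estimate to an exponential bound\<close>

context decaying_linear_flow
begin

text \<open>Multiplied by \<open>c\<close>, the constant coefficient
  \<open>\<gamma> / (2 * c)\<close> consumes half of the decay rate, while \<psi> with mass at most
  \<open>P\<close> costs the factor \<open>exp (c * P)\<close>. The level \<open>m\<close> of
  \<open>h\<close>, integrated against the exponential weight, yields
  \<open>2 * m / \<gamma>\<close>; the excess \<open>H\<close> enters through its mass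
  \<open>Q\<close>.\<close>

lemma practical_estimate:
  fixes x f :: "real \<Rightarrow> real^'n" and \<psi> h H :: "real \<Rightarrow> real"
  assumes a: "0 \<le> a" "a \<le> T"
    and x: "continuous_on {a..T} x" and f: "f integrable_on {a..T}"
    and eq: "\<And>t. t \<in> {a..T} \<Longrightarrow> x t = x a + integral {a..t} (\<lambda>s. A s *v x s + f s)"
    and fb: "\<And>s. s \<in> {a..T} \<Longrightarrow> norm (f s) \<le> (\<gamma> / (2 * c) + \<psi> s) * norm (x s) + h s"
    and \<psi>: "\<psi> integrable_on {a..T}" "\<And>s. s \<in> {a..T} \<Longrightarrow> 0 \<le> \<psi> s" "integral {a..T} \<psi> \<le> P"
    and h: "h integrable_on {a..T}" "\<And>s. s \<in> {a..T} \<Longrightarrow> 0 \<le> h s"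
    and H: "H integrable_on {a..T}" "\<And>s. s \<in> {a..T} \<Longrightarrow> 0 \<le> H s" "integral {a..T} H \<le> Q"
    and hH: "\<And>s. s \<in> {a..T} \<Longrightarrow> h s \<le> m + H s" and "m \<ge> 0"
  shows "norm (x T) \<le> c * exp (c * P) * (exp (- (\<gamma> / 2) * (T - a)) * norm (x a) + 2 * m / \<gamma> + Q)"
proof -
  define B where "B t = integral {a..t} (\<lambda>s. \<gamma> / (2 * c) + \<psi> s)" for t
  define E where "E t = exp (\<gamma> * t - c * B t)" for t
  \<comment> \<open>The exponent is what remains of the weight without \<psi>:
    \<open>\<gamma> * t - \<gamma> / 2 * (t - a)\<close>.\<close>
  define F where "F t = exp (\<gamma> / 2 * (t + a))" for t
  have \<psi>t: "\<psi> integrable_on {a..t}" if "t \<in> {a..T}" for t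
    using that by (intro integrable_subinterval_real[OF \<psi>(1)]) auto
  have B: "B t = \<gamma> / (2 * c) * (t - a) + integral {a..t} \<psi>" if "t \<in> {a..T}" for t
    using \<psi>t[OF that] that unfolding B_def by (subst integral_add) (auto simp: integrable_const_ivl)
  have E: "E t = F t * exp (- c * integral {a..t} \<psi>)" if "t \<in> {a..T}" for t
    unfolding E_def B[OF that] F_def using c by (simp add: mult_exp_exp field_simps)
  have main: "E T * norm (x T) \<le> c * E a * norm (x a) + c * integral {a..T} (\<lambda>s. E s * h s)"
    unfolding E_def B_def
    by (rule perturbed_estimate[OF a x f eq fb])
      (use \<psi> h c \<gamma> in \<open>auto intro!: integrable_add integrable_const_ivl add_nonneg_nonneg\<close>)
  have EF: "E t \<le> F t" if "t \<in> {a..T}" for t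
  proof -
    have "0 \<le> integral {a..t} \<psi>" using \<psi>t[OF that] \<psi>(2) that by (intro integral_nonneg) auto
    then have "exp (- c * integral {a..t} \<psi>) \<le> 1" using c by simp
    then show ?thesis unfolding E[OF that] by (simp add: F_def)
  qed
  have contF: "continuous_on {a..T} F" unfolding F_def by (intro continuous_intros)
  have contE: "continuous_on {a..T} E"
    unfolding E_def B_def
    by (intro continuous_intros indefinite_integral_continuous_1 integrable_add \<psi> integrable_const_ivl)
  have "(F has_integral (2 / \<gamma> * F T - 2 / \<gamma> * F a)) {a..T}"
    using a \<gamma> unfolding F_def
    by (intro fundamental_theorem_of_calculus)
      (auto intro!: derivative_eq_intros simp flip: has_real_derivative_iff_has_vector_derivative)
  then have Fint: "F integrable_on {a..T}" "integral {a..T} F \<le> 2 / \<gamma> * F T"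
    using \<gamma> by (auto simp: integral_unique has_integral_integrable F_def)
  have "integral {a..T} (\<lambda>s. E s * h s) \<le> integral {a..T} (\<lambda>s. F s * m + F T * H s)"
  proof (rule integral_le)
    show "(\<lambda>s. E s * h s) integrable_on {a..T}"
      by (rule integrable_continuous_mult_nonneg[OF contE h])
    show "(\<lambda>s. F s * m + F T * H s) integrable_on {a..T}"
      using Fint H by (intro integrable_add integrable_on_mult_left integrable_on_mult_right) auto
    fix s assume s: "s \<in> {a..T}"
    have "E s * h s \<le> F s * (m + H s)"
      using EF[OF s] h(2)[OF s] hH[OF s] by (intro mult_mono) (auto simp: F_def)
    also have "\<dots> = F s * m + F s * H s" by (rule distrib_left)
    \<comment> \<open>\<open>F\<close> is increasing, so putting its final value leaves only the
      mass of \<open>H\<close> to be estimated.\<close>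
    also have "F s * H s \<le> F T * H s"
      using s H(2)[OF s] \<gamma> by (intro mult_right_mono) (auto simp: F_def)
    finally show "E s * h s \<le> F s * m + F T * H s" by simp
  qed
  also have "\<dots> = integral {a..T} F * m + F T * integral {a..T} H"
    using Fint H by (subst integral_add) (auto intro: integrable_on_mult_left integrable_on_mult_right)
  also have "\<dots> \<le> 2 / \<gamma> * F T * m + F T * Q"
    using Fint H(3) \<open>m \<ge> 0\<close> by (intro add_mono mult_right_mono mult_left_mono) (auto simp: F_def)
  also have "\<dots> = F T * (2 * m / \<gamma> + Q)" by (simp add: algebra_simps)
  finally have int: "integral {a..T} (\<lambda>s. E s * h s) \<le> F T * (2 * m / \<gamma> + Q)" .
  have Ea: "E a = F T * exp (- (\<gamma> / 2) * (T - a))"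
    using E[of a] a by (simp add: F_def mult_exp_exp) (simp add: field_simps)
  \<comment> \<open>With the final weight bounded below in this way, \<open>F T\<close> cancels and
    the bound depends on the times only through \<open>T - a\<close>.\<close>
  have "F T * exp (- c * P) \<le> E T"
    using E[of T] a c \<psi>(3) by (simp add: F_def)
  then have "F T * exp (- c * P) * norm (x T) \<le> E T * norm (x T)" by (intro mult_right_mono) auto
  also have "\<dots> \<le> c * E a * norm (x a) + c * (F T * (2 * m / \<gamma> + Q))"
    using main int c by (smt (verit) mult_left_mono)
  also have "\<dots> = F T * (c * (exp (- (\<gamma> / 2) * (T - a)) * norm (x a) + 2 * m / \<gamma> + Q))"
    unfolding Ea by (simp add: algebra_simps)
  finally have "exp (- c * P) * norm (x T) \<le> c * (exp (- (\<gamma> / 2) * (T - a)) * norm (x a) + 2 * m / \<gamma> + Q)"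
    by (simp add: F_def mult.assoc)
  then show ?thesis by (simp add: exp_minus field_simps)
qed

end

section \<open>Solutions of the perturbed system\<close>

text \<open>The integral equation can be restarted at any time of \<open>I\<close> by subtracting
  its instances at \<open>s\<close> and \<open>t\<close>. Continuity is not part of
  \<open>solution_on\<close>; it is inherited from the indefinite integral.\<close>

lemma solution_on_increment:
  assumes "solution_on F t0 x0 I x" "s \<in> I" "t \<in> I" "s \<le> t"
  shows "x t = x s + integral {s..t} (\<lambda>u. F u (x u))"
    and "(\<lambda>u. F u (x u)) absolutely_integrable_on {s..t}"
    and "continuous_on {s..t} x"
proof -
  have t0: "t0 \<in> I" "t0 \<le> s" "is_interval I" using assms by (auto simp: solution_on_def)
  have ai: "(\<lambda>u. F u (x u)) absolutely_integrable_on {t0..t}"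
    using assms by (auto simp: solution_on_def)
  then have i: "(\<lambda>u. F u (x u)) integrable_on {t0..t}" by (simp add: absolutely_integrable_on_def)
  have eq: "x u = x0 + integral {t0..u} (\<lambda>u. F u (x u))" if "u \<in> I" for u
    using assms that by (auto simp: solution_on_def)
  show "x t = x s + integral {s..t} (\<lambda>u. F u (x u))"
    using eq[of s] eq[of t] assms Henstock_Kurzweil_Integration.integral_combine[OF t0(2) assms(4) i]
    by simp
  show "(\<lambda>u. F u (x u)) absolutely_integrable_on {s..t}"
    by (rule absolutely_integrable_on_subinterval[OF ai]) (use t0 in auto)
  have "{t0..t} \<subseteq> I" using t0(1,3) assms(3) by (meson atLeastAtMost_iff mem_is_interval_1_I subsetI)
  have "continuous_on {t0..t} (\<lambda>v. x0 + integral {t0..v} (\<lambda>u. F u (x u)))"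
    by (intro continuous_intros indefinite_integral_continuous_1 i)
  moreover have "x0 + integral {t0..v} (\<lambda>u. F u (x u)) = x v" if "v \<in> {t0..t}" for v
    using eq[of v] \<open>{t0..t} \<subseteq> I\<close> that by auto
  ultimately have "continuous_on {t0..t} x" by (rule continuous_on_eq)
  then show "continuous_on {s..t} x" by (rule continuous_on_subset) (use t0 in auto)
qed

text \<open>Bounding every piece by the mass over the half-line is what makes the later constants
  independent of the initial time.\<close>

lemma integral_le_halfline:
  fixes H :: "real \<Rightarrow> real"
  assumes "H absolutely_integrable_on {0..}" "\<And>t. 0 \<le> t \<Longrightarrow> 0 \<le> H t" "0 \<le> a"
  shows "H integrable_on {a..b}" "integral {a..b} H \<le> integral {0..} H"
proof -
  have "H absolutely_integrable_on {a..b}"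
    by (rule absolutely_integrable_on_subinterval[OF assms(1)]) (use assms in auto)
  then show 1: "H integrable_on {a..b}" by (simp add: absolutely_integrable_on_def)
  show "integral {a..b} H \<le> integral {0..} H"
    by (rule integral_subset_le) (use assms 1 in \<open>auto simp: absolutely_integrable_on_def\<close>)
qed

text \<open>A common form for membership in an \<open>L^p\<close> space and for convergence to 0: in
  the estimates the exponents matter only through the levels \<open>m\<close> that are admissible.
  Only the majorant \<open>H\<close> is asked to be integrable; local integrability of
  \<open>h\<close> itself is a separate property.\<close>

definition integrable_excess :: "(real \<Rightarrow> real) \<Rightarrow> real \<Rightarrow> bool" where
  "integrable_excess h m \<longleftrightarrow>
     (\<exists>H. H absolutely_integrable_on {0..} \<and> (\<forall>t\<ge>0. 0 \<le> H t \<and> h t \<le> m + H t))"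

text \<open>The nonlinear growth has already been absorbed here. The constant share
  \<open>\<gamma> / (2 * c)\<close> is the one that costs exactly half of the decay rate.\<close>

locale linearly_bounded_perturbation = decaying_linear_flow A R c \<gamma>
  for A :: "real \<Rightarrow> real^'n^'n" and R c \<gamma> +
  fixes g :: "real \<Rightarrow> real^'n \<Rightarrow> real^'n" and \<psi> h :: "real \<Rightarrow> real"
  assumes g: "0 \<le> t \<Longrightarrow> norm (g t v) \<le> (\<gamma> / (2 * c) + \<psi> t) * norm v + h t"
    and \<psi>: "\<psi> absolutely_integrable_on {0..}" "0 \<le> t \<Longrightarrow> 0 \<le> \<psi> t"
    and h: "locally_integrable_halfline h" "0 \<le> t \<Longrightarrow> 0 \<le> h t"
begin

text \<open>The first factor comes from comparing the adapted norm with the Euclidean one, the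
  exponential is the Gronwall factor of \<psi>.\<close>

definition gain :: real where "gain = c * exp (c * integral {0..} \<psi>)"

lemma gain_pos: "gain > 0" using c by (simp add: gain_def)

lemma h_integrable: "0 \<le> a \<Longrightarrow> h absolutely_integrable_on {a..b}"
proof -
  assume "0 \<le> a"
  have "h absolutely_integrable_on {0..max 0 b}"
    using h(1) by (simp add: locally_integrable_halfline_def)
  then show ?thesis by (rule absolutely_integrable_on_subinterval) (use \<open>0 \<le> a\<close> in auto)
qed

text \<open>The start \<open>s\<close> may be any time of \<open>I\<close>, and \<open>Q\<close> has
  to bound the mass of \<open>H\<close> on \<open>{s..t}\<close> only: a late start makes
  \<open>Q\<close> small, which attractivity exploits.\<close>

lemma solution_estimate:
  assumes sol: "solution_on (perturbed_rhs A g) t0 x0 I x" and "0 \<le> t0"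
    and I: "s \<in> I" "t \<in> I" "s \<le> t"
    and H: "H absolutely_integrable_on {0..}" "\<And>t. 0 \<le> t \<Longrightarrow> 0 \<le> H t" "\<And>t. 0 \<le> t \<Longrightarrow> h t \<le> m + H t"
      "integral {s..t} H \<le> Q"
    and "m \<ge> 0"
  shows "norm (x t) \<le> gain * (exp (- (\<gamma> / 2) * (t - s)) * norm (x s) + 2 * m / \<gamma> + Q)"
proof -
  have s_nonneg: "0 \<le> s" using sol \<open>0 \<le> t0\<close> I(1) unfolding solution_on_def by force
  show ?thesis
    unfolding gain_def
  proof (rule practical_estimate[where \<psi> = \<psi> and h = h and H = H and f = "\<lambda>u. g u (x u)"])
    show s: "0 \<le> s" "s \<le> t" using s_nonneg I(3) .
    show x: "continuous_on {s..t} x" by (rule solution_on_increment[OF sol I])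
    have "continuous_on {s..t} A" using A by (rule continuous_on_subset) (use s in auto)
    then have "(\<lambda>u. A u *v x u) integrable_on {s..t}"
      by (intro integrable_continuous_real bounded_bilinear.continuous_on[OF bounded_bilinear_matrix_vector_mult] x)
    moreover have "(\<lambda>u. perturbed_rhs A g u (x u)) integrable_on {s..t}"
      using solution_on_increment(2)[OF sol I] by (simp add: absolutely_integrable_on_def)
    ultimately have "(\<lambda>u. perturbed_rhs A g u (x u) - A u *v x u) integrable_on {s..t}"
      by (intro integrable_diff)
    then show "(\<lambda>u. g u (x u)) integrable_on {s..t}" by (simp add: perturbed_rhs_def)
    show "x \<tau> = x s + integral {s..\<tau>} (\<lambda>u. A u *v x u + g u (x u))" if "\<tau> \<in> {s..t}" for \<tau>
    proof -
      have "\<tau> \<in> I" using that I sol unfolding solution_on_def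
        by (meson atLeastAtMost_iff mem_is_interval_1_I)
      then show ?thesis using solution_on_increment(1)[OF sol I(1), of \<tau>] that
        by (simp add: perturbed_rhs_def)
    qed
    show "h integrable_on {s..t}"
      using h_integrable[OF s(1), of t] by (simp add: absolutely_integrable_on_def)
    show "norm (g \<tau> (x \<tau>)) \<le> (\<gamma> / (2 * c) + \<psi> \<tau>) * norm (x \<tau>) + h \<tau>" if "\<tau> \<in> {s..t}" for \<tau>
      using g[of \<tau>] that s by simp
    show "\<psi> integrable_on {s..t}" "integral {s..t} \<psi> \<le> integral {0..} \<psi>"
      using integral_le_halfline[OF \<psi> s(1)] by auto
    show "H integrable_on {s..t}" by (rule integral_le_halfline(1)[OF H(1,2) s(1)])
  qed (use s_nonneg \<psi>(2) h(2) H \<open>m \<ge> 0\<close> in auto)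
qed

end

section \<open>Decomposition of the bounds\<close>

lemma integrable_excess_add:
  assumes "integrable_excess f m" "integrable_excess f' m'"
  shows "integrable_excess (\<lambda>t. f t + f' t) (m + m')"
proof -
  obtain H H' where "H absolutely_integrable_on {0..}" "H' absolutely_integrable_on {0..}"
    "\<And>t. t \<ge> 0 \<Longrightarrow> 0 \<le> H t \<and> f t \<le> m + H t" "\<And>t. t \<ge> 0 \<Longrightarrow> 0 \<le> H' t \<and> f' t \<le> m' + H' t"
    using assms unfolding integrable_excess_def by blast
  then show ?thesis unfolding integrable_excess_def
    by (intro exI[of _ "\<lambda>t. H t + H' t"]) (force intro!: set_integral_add)
qed

lemma integrable_excess_cmult:
  assumes "integrable_excess f m" "k \<ge> 0"
  shows "integrable_excess (\<lambda>t. k * f t) (k * m)"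
proof -
  obtain H where H: "H absolutely_integrable_on {0..}" "\<And>t. t \<ge> 0 \<Longrightarrow> 0 \<le> H t \<and> f t \<le> m + H t"
    using assms unfolding integrable_excess_def by blast
  have "k * f t \<le> k * m + k * H t" if "t \<ge> 0" for t
    using mult_left_mono[of "f t" "m + H t" k] H(2)[OF that] assms(2) by (simp add: distrib_left)
  then show ?thesis unfolding integrable_excess_def using H assms(2)
    by (intro exI[of _ "\<lambda>t. k * H t"]) auto
qed

lemma absolutely_integrable_on_iff_integrable:
  fixes f :: "'a::euclidean_space \<Rightarrow> 'b::euclidean_space"
  assumes "S \<in> sets lebesgue"
  shows "f absolutely_integrable_on S \<longleftrightarrow> integrable (lebesgue_on S) f"
proof -
  have "S \<inter> space lebesgue \<in> sets lebesgue" using assms by simp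
  from integrable_restrict_space[OF this] show ?thesis unfolding set_integrable_def by (rule sym)
qed

text \<open>The majorant is \<open>f\<close> cut off to the set where \<open>f > m\<close>. For
  finite \<open>p\<close> that set is handled as in Chebyshev's inequality; for infinite
  \<open>p\<close> and \<open>m\<close> above an essential bound the cut-off vanishes almost
  everywhere.\<close>

lemma in_Lp_integrable_excess:
  assumes Lp: "in_Lp (lebesgue_on {0..}) p f" and "1 \<le> p" and nonneg: "\<And>t. t \<ge> 0 \<Longrightarrow> 0 \<le> f t"
  shows "\<exists>m\<ge>0. integrable_excess f m" and "p < \<infinity> \<Longrightarrow> m > 0 \<Longrightarrow> integrable_excess f m"
proof -
  have meas[measurable]: "f \<in> borel_measurable (lebesgue_on {0..})"
    using Lp by (simp add: in_Lp_def)
  have excess: "integrable_excess f m" if "m \<ge> 0" and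
    int: "integrable (lebesgue_on {0..}) (\<lambda>t. indicator {m<..} (f t) * f t)" for m
    unfolding integrable_excess_def
  proof (intro exI[of _ "\<lambda>t. indicator {m<..} (f t) * f t"] conjI allI impI)
    show "(\<lambda>t. indicator {m<..} (f t) * f t) absolutely_integrable_on {0..}"
      using int by (simp add: absolutely_integrable_on_iff_integrable)
  qed (use nonneg \<open>m \<ge> 0\<close> in \<open>auto simp: indicator_def\<close>)
  have fin: "integrable_excess f m" if "p < \<infinity>" "m > 0" for m
  proof (rule excess)
    define q where "q = enn2real p"
    have q: "q \<ge> 1"
      using \<open>1 \<le> p\<close> \<open>p < \<infinity>\<close> enn2real_mono[of 1 p] by (simp add: q_def)
    have fq: "integrable (lebesgue_on {0..}) (\<lambda>t. \<bar>f t\<bar> powr q)"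
      using Lp \<open>p < \<infinity>\<close> by (simp add: in_Lp_def q_def)
    show "integrable (lebesgue_on {0..}) (\<lambda>t. indicator {m<..} (f t) * f t)"
    proof (rule Bochner_Integration.integrable_bound)
      show "integrable (lebesgue_on {0..}) (\<lambda>t. m powr (1 - q) * \<bar>f t\<bar> powr q)"
        using fq by simp
      show "(\<lambda>t. indicator {m<..} (f t) * f t) \<in> borel_measurable (lebesgue_on {0..})"
        by measurable
      show "AE t in lebesgue_on {0..}. norm (indicator {m<..} (f t) * f t) \<le> norm (m powr (1 - q) * \<bar>f t\<bar> powr q)"
      proof (rule AE_I2)
        fix t
        show "norm (indicator {m<..} (f t) * f t) \<le> norm (m powr (1 - q) * \<bar>f t\<bar> powr q)"
        proof (cases "f t > m")
          case True
          \<comment> \<open>Since \<open>1 - q \<le> 0\<close>, the first factor is largest at the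
            threshold \<open>m\<close>.\<close>
          then have "f t = f t powr (1 - q) * f t powr q"
            using \<open>m > 0\<close> by (simp flip: powr_add)
          also have "\<dots> \<le> m powr (1 - q) * f t powr q"
            using True q \<open>m > 0\<close> by (intro mult_right_mono powr_mono2') auto
          finally show ?thesis using True \<open>m > 0\<close> by simp
        qed simp
      qed
    qed
  qed (use that in simp)
  then show "p < \<infinity> \<Longrightarrow> m > 0 \<Longrightarrow> integrable_excess f m" .
  show "\<exists>m\<ge>0. integrable_excess f m"
  proof (cases "p = \<infinity>")
    case True
    then obtain C where C: "AE t in lebesgue_on {0..}. \<bar>f t\<bar> \<le> C" using Lp by (auto simp: in_Lp_def)
    define m where "m = max 0 C"
    have "integrable_excess f m"
    proof (rule excess)
      have "AE t in lebesgue_on {0..}. indicator {m<..} (f t) * f t = 0"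
        using C by eventually_elim (auto simp: m_def indicator_def)
      then show "integrable (lebesgue_on {0..}) (\<lambda>t. indicator {m<..} (f t) * f t)"
        by (subst integrable_cong_AE[where g = "\<lambda>t. 0"]) auto
    qed (simp add: m_def)
    then show ?thesis by (intro exI[of _ m]) (simp add: m_def)
  next
    case False
    then have "p < \<infinity>" by (simp add: less_top)
    then show ?thesis using fin[of 1] by (intro exI[of _ 1]) simp
  qed
qed

text \<open>On a bounded interval the constant \<open>m\<close> is integrable as well, so
  \<open>m + H\<close> dominates the measurable function \<open>f\<close>.\<close>

lemma locally_integrable_halfline_excess:
  assumes "f \<in> borel_measurable (lebesgue_on {0..})" "integrable_excess f m"
    and "\<And>t. t \<ge> 0 \<Longrightarrow> 0 \<le> f t"
  shows "locally_integrable_halfline f"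
  unfolding locally_integrable_halfline_def
proof (intro allI impI)
  fix T :: real assume "T \<ge> 0"
  obtain H where H: "H absolutely_integrable_on {0..}" "\<And>t. t \<ge> 0 \<Longrightarrow> 0 \<le> H t \<and> f t \<le> m + H t"
    using assms unfolding integrable_excess_def by blast
  show "f absolutely_integrable_on {0..T}"
  proof (rule measurable_bounded_by_integrable_imp_absolutely_integrable)
    show "f \<in> borel_measurable (lebesgue_on {0..T})"
      using assms(1) by (rule measurable_restrict_mono) auto
    have "H absolutely_integrable_on {0..T}"
      by (rule absolutely_integrable_on_subinterval[OF H(1)]) auto
    then show "(\<lambda>t. m + H t) integrable_on {0..T}"
      by (intro integrable_add integrable_const_ivl) (simp add: absolutely_integrable_on_def)
    show "norm (f t) \<le> m + H t" if "t \<in> {0..T}" for t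
      using H(2)[of t] assms(3)[of t] that by simp
  qed simp
qed

lemma absolutely_integrable_on_extend_by_zero:
  fixes f :: "'a::euclidean_space \<Rightarrow> 'b::euclidean_space"
  assumes "f absolutely_integrable_on S" "S \<subseteq> T"
  shows "(\<lambda>t. if t \<in> S then f t else 0) absolutely_integrable_on T"
proof -
  have "(\<lambda>t. indicat_real T t *\<^sub>R (if t \<in> S then f t else 0)) = (\<lambda>t. indicat_real S t *\<^sub>R f t)"
    using assms(2) by (auto simp: indicator_def fun_eq_iff)
  then show ?thesis using assms(1) by (simp add: set_integrable_def)
qed

text \<open>Beyond some time \<open>f\<close> stays below 1; up to that time \<open>f\<close> serves
  as its own majorant, by local integrability.\<close>

lemma vanishing_integrable_excess:
  assumes f: "locally_integrable_halfline f" "(f \<longlongrightarrow> 0) at_top"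
    and nonneg: "\<And>t. t \<ge> 0 \<Longrightarrow> 0 \<le> f t"
  shows "integrable_excess f 1"
proof -
  have "eventually (\<lambda>t. f t < 1) at_top" using f(2) by (rule order_tendstoD) simp
  then obtain T where T: "\<And>t. t \<ge> T \<Longrightarrow> f t < 1" by (auto simp: eventually_at_top_linorder)
  define S where "S = max T 0"
  have "f absolutely_integrable_on {0..S}" using f(1) by (simp add: locally_integrable_halfline_def S_def)
  then have "(\<lambda>t. if t \<in> {0..S} then f t else 0) absolutely_integrable_on {0..}"
    by (rule absolutely_integrable_on_extend_by_zero) auto
  then show ?thesis unfolding integrable_excess_def
  proof (intro exI conjI allI impI)
    fix t :: real assume "0 \<le> t"
    then show "f t \<le> 1 + (if t \<in> {0..S} then f t else 0)"
      using T[of t] by (cases "t \<le> S"; cases "T \<le> t") (auto simp: S_def)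
  qed (use nonneg in auto)
qed

text \<open>Beyond a threshold the limit gives a bound by \<open>\<epsilon> * s powr l\<close>, and
  \<open>s powr l \<le> s\<close> because the threshold is at least 1. Below it, monotonicity bounds
  \<omega> by its value there, which is the constant \<open>K\<close>.\<close>

lemma sublinear_growth:
  fixes \<omega> :: "real \<Rightarrow> real"
  assumes nonneg: "\<And>s. s \<ge> 0 \<Longrightarrow> 0 \<le> \<omega> s" and mono: "mono_on {0..} \<omega>"
    and l: "l \<le> 1" and lim: "((\<lambda>s. \<omega> s / s powr l) \<longlongrightarrow> 0) at_top" and "\<epsilon> > 0"
  obtains K where "K \<ge> 0" "\<And>s. s \<ge> 0 \<Longrightarrow> \<omega> s \<le> \<epsilon> * s + K"
proof -
  have "eventually (\<lambda>s. \<omega> s / s powr l < \<epsilon>) at_top" using lim \<open>\<epsilon> > 0\<close> by (rule order_tendstoD)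
  then obtain S where S: "\<And>s. s \<ge> S \<Longrightarrow> \<omega> s / s powr l < \<epsilon>" by (auto simp: eventually_at_top_linorder)
  define S' where "S' = max S 1"
  have "\<omega> s \<le> \<epsilon> * s + \<omega> S'" if "s \<ge> 0" for s
  proof (cases "s \<ge> S'")
    case True
    then have "\<omega> s < \<epsilon> * s powr l" using S[of s] by (simp add: S'_def field_simps)
    also have "\<epsilon> * s powr l \<le> \<epsilon> * s powr 1"
      using True l \<open>\<epsilon> > 0\<close> by (intro mult_left_mono powr_mono) (auto simp: S'_def)
    finally show ?thesis using True nonneg[of S'] by (simp add: S'_def max_def split: if_splits)
  next
    case False
    then have "\<omega> s \<le> \<omega> S'" using mono_onD[OF mono, of s S'] that by simp
    then show ?thesis using that \<open>\<epsilon> > 0\<close> by (simp add: add_increasing)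
  qed
  then show ?thesis using that[of "\<omega> S'"] nonneg[of S'] by (simp add: S'_def)
qed

section \<open>Boundedness, attractivity and continuation of solutions\<close>

lemma solution_on_cong:
  assumes sol: "solution_on F t0 x0 I x" and eq: "\<And>t. t \<in> I \<Longrightarrow> y t = x t"
  shows "solution_on F t0 x0 I y"
proof -
  have I: "is_interval I" "t0 \<in> I" "I \<subseteq> {t0..}" using sol by (auto simp: solution_on_def)
  have "(\<lambda>s. F s (y s)) absolutely_integrable_on {t0..t} \<and> y t = x0 + integral {t0..t} (\<lambda>s. F s (y s))"
    if "t \<in> I" for t
  proof -
    have sub: "s \<in> I" if "s \<in> {t0..t}" for s
      using I \<open>t \<in> I\<close> that by (meson atLeastAtMost_iff mem_is_interval_1_I)
    have x: "(\<lambda>s. F s (x s)) absolutely_integrable_on {t0..t}" "x t = x0 + integral {t0..t} (\<lambda>s. F s (x s))"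
      using sol \<open>t \<in> I\<close> unfolding solution_on_def by blast+
    have "integral {t0..t} (\<lambda>s. F s (y s)) = integral {t0..t} (\<lambda>s. F s (x s))"
      by (rule Henstock_Kurzweil_Integration.integral_cong) (simp add: eq sub)
    moreover have "(\<lambda>s. F s (y s)) absolutely_integrable_on {t0..t} \<longleftrightarrow> (\<lambda>s. F s (x s)) absolutely_integrable_on {t0..t}"
      by (rule set_integrable_cong) (simp_all add: eq sub)
    ultimately show ?thesis using x eq[OF that] by simp
  qed
  then show ?thesis using I by (simp add: solution_on_def)
qed

lemma solution_on_combine:
  assumes 1: "solution_on F t0 x0 {t0..T} x" and 2: "solution_on F T (x T) {T..<T + \<epsilon>} x"
  shows "solution_on F t0 x0 {t0..<T + \<epsilon>} x"
proof -
  have T: "t0 \<le> T" "T < T + \<epsilon>" using 1 2 by (auto simp: solution_on_def)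
  have "(\<lambda>s. F s (x s)) absolutely_integrable_on {t0..t} \<and> x t = x0 + integral {t0..t} (\<lambda>s. F s (x s))"
    if t: "t \<in> {t0..<T + \<epsilon>}" for t
  proof (cases "t \<le> T")
    case True then show ?thesis using 1 t by (simp add: solution_on_def)
  next
    case False
    have a: "(\<lambda>s. F s (x s)) absolutely_integrable_on {t0..T}" "x T = x0 + integral {t0..T} (\<lambda>s. F s (x s))"
      using 1 T unfolding solution_on_def by (meson atLeastAtMost_iff order_refl)+
    have b: "(\<lambda>s. F s (x s)) absolutely_integrable_on {T..t}" "x t = x T + integral {T..t} (\<lambda>s. F s (x s))"
      using 2 t False unfolding solution_on_def by (meson atLeastLessThan_iff linear)+
    have ab: "(\<lambda>s. F s (x s)) absolutely_integrable_on {t0..t}"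
      using absolutely_integrable_on_combine[OF a(1) b(1)] T False by simp
    then have "integral {t0..T} (\<lambda>s. F s (x s)) + integral {T..t} (\<lambda>s. F s (x s)) = integral {t0..t} (\<lambda>s. F s (x s))"
      using T False by (intro Henstock_Kurzweil_Integration.integral_combine) (auto simp: absolutely_integrable_on_def)
    then show ?thesis using a(2) b(2) ab by simp
  qed
  moreover have "{t0..<T + \<epsilon>} \<subseteq> {t0..}" by auto
  ultimately show ?thesis using T by (simp add: solution_on_def is_interval_co)
qed

text \<open>An integrable bound on the velocity up to \<open>T\<close> makes the integral converge
  as the end approaches \<open>T\<close>; its limit is the value to be given to the solution at
  \<open>T\<close>.\<close>

lemma solution_on_right_end:
  assumes sol: "solution_on F t0 x0 {t0..<T} x" and "t0 < T"
    and k: "k integrable_on {t0..T}" "\<And>s. s \<in> {t0..T} \<Longrightarrow> 0 \<le> k s"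
    and Fk: "\<And>s. t0 \<le> s \<Longrightarrow> s < T \<Longrightarrow> norm (F s (x s)) \<le> k s"
  shows "\<exists>y. (\<forall>t\<in>{t0..<T}. y t = x t) \<and> solution_on F t0 x0 {t0..T} y"
proof -
  \<comment> \<open>At \<open>T\<close> the given \<open>x\<close> carries no information; the value
    0 is a placeholder at a single point, a null set.\<close>
  define G where "G s = (if s < T then F s (x s) else 0)" for s
  \<comment> \<open>The intervals \<open>{t0..T - e n}\<close> exhaust \<open>{t0..<T}\<close>;
    integrability of \<open>G\<close> follows by dominated convergence of the truncations to
    them.\<close>
  define e where "e n = (T - t0) / real (n + 1)" for n
  have e: "e n > 0" for n using \<open>t0 < T\<close> by (simp add: e_def)
  have "e \<longlonglongrightarrow> 0"
    unfolding e_def using LIMSEQ_ignore_initial_segment[OF lim_const_over_n[of "T - t0"], of 1] by simp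
  have G: "G absolutely_integrable_on {t0..T}"
  proof (rule dominated_convergence_absolutely_integrable[OF _ k(1)])
    fix n
    have "(\<lambda>s. F s (x s)) absolutely_integrable_on {t0..T - e n}"
    proof (cases "t0 \<le> T - e n")
      case True then show ?thesis using sol e[of n] by (simp add: solution_on_def)
    qed simp
    then show "(\<lambda>s. if s \<in> {t0..T - e n} then F s (x s) else 0) absolutely_integrable_on {t0..T}"
      by (rule absolutely_integrable_on_extend_by_zero) (use e[of n] in auto)
  next
    fix s assume s: "s \<in> {t0..T}"
    then show "norm (G s) \<le> k s" using Fk[of s] k(2)[OF s] by (simp add: G_def)
    show "(\<lambda>n. if s \<in> {t0..T - e n} then F s (x s) else 0) \<longlonglongrightarrow> G s"
    proof (cases "s < T")
      case True
      then have "eventually (\<lambda>n. e n < T - s) sequentially"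
        using order_tendstoD(2)[OF \<open>e \<longlonglongrightarrow> 0\<close>, of "T - s"] by simp
      then have "eventually (\<lambda>n. (if s \<in> {t0..T - e n} then F s (x s) else 0) = G s) sequentially"
        by eventually_elim (use s True in \<open>auto simp: G_def\<close>)
      then show ?thesis by (rule tendsto_eventually)
    next
      case False
      then have "s \<notin> {t0..T - e n}" for n using e[of n] by auto
      then show ?thesis using False by (simp only: G_def if_False tendsto_const)
    qed
  qed
  define y where "y s = (if s < T then x s else x0 + integral {t0..T} G)" for s
  have "solution_on F t0 x0 {t0..<T} y"
    by (rule solution_on_cong[OF sol]) (simp add: y_def)
  moreover have "(\<lambda>s. F s (y s)) absolutely_integrable_on {t0..T}"
    by (rule absolutely_integrable_spike[OF G, of "{T}"]) (auto simp: G_def y_def)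
  moreover have "integral {t0..T} (\<lambda>s. F s (y s)) = integral {t0..T} G"
    by (rule integral_spike[of "{T}"]) (auto simp: G_def y_def)
  ultimately have "solution_on F t0 x0 {t0..T} y"
    using \<open>t0 < T\<close> unfolding solution_on_def
    by (simp add: is_interval_cc) (metis atLeastAtMost_iff atLeastLessThan_iff le_less y_def)
  then show ?thesis by (intro exI[of _ y]) (simp add: y_def)
qed

section \<open>Uniform bound, convergence to zero and global existence\<close>

context linearly_bounded_perturbation
begin

text \<open>The constant \<open>r\<close> is fixed before the initial data and the solution, because
  it uses the mass of \<open>H\<close> over the whole half-line.\<close>

lemma uniform_solution_bound:
  assumes "integrable_excess h m" "m \<ge> 0"
  obtains r where "r \<ge> 0"
    "\<And>t0 x0 I x s t. solution_on (perturbed_rhs A g) t0 x0 I x \<Longrightarrow> 0 \<le> t0 \<Longrightarrow> s \<in> I \<Longrightarrow> t \<in> I \<Longrightarrow> s \<le> t \<Longrightarrow>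
      norm (x t) \<le> gain * (exp (- (\<gamma> / 2) * (t - s)) * norm (x s) + r)"
proof -
  obtain H where H: "H absolutely_integrable_on {0..}" "\<And>t. t \<ge> 0 \<Longrightarrow> 0 \<le> H t"
    "\<And>t. t \<ge> 0 \<Longrightarrow> h t \<le> m + H t"
    using assms unfolding integrable_excess_def by blast
  define r where "r = 2 * m / \<gamma> + integral {0..} H"
  have "integral {0..} H \<ge> 0" using H by (intro integral_nonneg) (auto simp: absolutely_integrable_on_def)
  then have "r \<ge> 0" using assms(2) \<gamma> by (simp add: r_def)
  moreover have "norm (x t) \<le> gain * (exp (- (\<gamma> / 2) * (t - s)) * norm (x s) + r)"
    if sol: "solution_on (perturbed_rhs A g) t0 x0 I x" and st: "0 \<le> t0" "s \<in> I" "t \<in> I" "s \<le> t"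
    for t0 x0 I x s t
  proof -
    have "0 \<le> s" using sol st unfolding solution_on_def by force
    then show ?thesis
      using solution_estimate[OF sol st H(1,2,3) integral_le_halfline(2)[OF H(1,2)] assms(2)]
      by (simp add: r_def add.assoc)
  qed
  ultimately show ?thesis using that by blast
qed

text \<open>Three contributions, each at most \<delta>: the level \<open>m\<close>, the tail of the
  integral of \<open>H\<close> after a late time \<open>S\<close>, and the decaying memory of
  \<open>x S\<close>. The solution is restarted at \<open>S\<close>.\<close>

lemma solution_tendsto_zero:
  assumes ex: "\<And>m. m > 0 \<Longrightarrow> integrable_excess h m"
    and sol: "solution_on (perturbed_rhs A g) t0 x0 {t0..} x" and "0 \<le> t0"
  shows "(x \<longlongrightarrow> 0) at_top"
proof (rule tendstoI)
  fix \<epsilon> :: real assume "\<epsilon> > 0"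
  define \<delta> where "\<delta> = \<epsilon> / (3 * gain)"
  have \<delta>: "\<delta> > 0" using \<open>\<epsilon> > 0\<close> gain_pos by (simp add: \<delta>_def)
  \<comment> \<open>Chosen so that \<open>2 * m / \<gamma> = \<delta>\<close>.\<close>
  define m where "m = \<gamma> * \<delta> / 2"
  have m: "m > 0" using \<delta> \<gamma> by (simp add: m_def)
  obtain H where H: "H absolutely_integrable_on {0..}" "\<And>t. t \<ge> 0 \<Longrightarrow> 0 \<le> H t"
    "\<And>t. t \<ge> 0 \<Longrightarrow> h t \<le> m + H t"
    using ex[OF m] unfolding integrable_excess_def by blast
  define J where "J t = integral {t0..t} H" for t
  have "bdd_above (J ` {t0..})"
    by (rule bdd_aboveI2[of _ _ "integral {0..} H"])
      (use integral_le_halfline(2)[OF H(1,2)] \<open>0 \<le> t0\<close> in \<open>auto simp: J_def\<close>)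
  moreover have "Sup (J ` {t0..}) - \<delta> < Sup (J ` {t0..})" using \<delta> by simp
  \<comment> \<open>\<open>J S\<close> is within \<delta> of the supremum of \<open>J\<close>, so at
    most \<delta> of the mass of \<open>H\<close> lies beyond \<open>S\<close>.\<close>
  ultimately obtain S where S: "S \<ge> t0" "Sup (J ` {t0..}) - \<delta> < J S"
    by (subst (asm) less_cSUP_iff) auto
  have tail: "integral {S..t} H \<le> \<delta>" if "t \<ge> S" for t
  proof -
    have "J t \<le> Sup (J ` {t0..})" using \<open>bdd_above (J ` {t0..})\<close> S that by (intro cSUP_upper) auto
    moreover have "J S + integral {S..t} H = J t"
      unfolding J_def using S that integral_le_halfline(1)[OF H(1,2) \<open>0 \<le> t0\<close>]
      by (intro Henstock_Kurzweil_Integration.integral_combine) auto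
    ultimately show ?thesis using S by linarith
  qed
  have "((\<lambda>t. exp (- (\<gamma> / 2) * (- S + t)) * norm (x S)) \<longlongrightarrow> 0) at_top"
    by (intro tendsto_mult_left_zero filterlim_compose[OF exp_at_bot]
        filterlim_tendsto_neg_mult_at_bot[OF tendsto_const]
        filterlim_tendsto_add_at_top[OF tendsto_const filterlim_ident]) (use \<gamma> in simp)
  then have "eventually (\<lambda>t. exp (- (\<gamma> / 2) * (- S + t)) * norm (x S) < \<delta>) at_top"
    using \<delta> by (rule order_tendstoD)
  then show "eventually (\<lambda>t. dist (x t) 0 < \<epsilon>) at_top"
    using eventually_ge_at_top[of S]
  proof eventually_elim
    case (elim t)
    have "norm (x t) \<le> gain * (exp (- (\<gamma> / 2) * (t - S)) * norm (x S) + 2 * m / \<gamma> + \<delta>)"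
      using solution_estimate[OF sol \<open>0 \<le> t0\<close> _ _ elim(2) H tail[OF elim(2)]] S elim m by simp
    also have "\<dots> < gain * (\<delta> + \<delta> + \<delta>)"
      using elim(1) gain_pos \<gamma> by (intro mult_strict_left_mono) (auto simp: m_def)
    also have "\<dots> = \<epsilon>" using gain_pos by (simp add: \<delta>_def field_simps)
    finally show ?case by simp
  qed
qed

text \<open>Otherwise \<open>I\<close> has a finite supremum \<open>T\<close>. If \<open>T\<close>
  belongs to \<open>I\<close>, local solvability at \<open>x T\<close> continues the solution past
  \<open>T\<close>. If not, the a priori bound makes the velocity integrable up to \<open>T\<close>,
  so the end point can be added. Either extension contradicts maximality.\<close>

lemma maximal_solution_global:
  assumes ex: "integrable_excess h m" "m \<ge> 0" and "0 \<le> t0"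
    and max: "maximal_solution_on (perturbed_rhs A g) t0 x0 I x"
    and loc: "\<And>s. s \<in> I \<Longrightarrow> locally_solvable (perturbed_rhs A g) s (x s)"
  shows "I = {t0..}"
proof (rule ccontr)
  assume "I \<noteq> {t0..}"
  let ?F = "perturbed_rhs A g"
  have sol: "solution_on ?F t0 x0 I x" using max by (simp add: maximal_solution_on_def)
  have no_ext: "J = I" if "solution_on ?F t0 x0 J y" "I \<subseteq> J" "\<And>t. t \<in> I \<Longrightarrow> y t = x t" for J y
    using max that unfolding maximal_solution_on_def by blast
  have I: "is_interval I" "t0 \<in> I" "I \<subseteq> {t0..}" using sol by (auto simp: solution_on_def)
  have down: "s \<in> I" if "t \<in> I" "t0 \<le> s" "s \<le> t" for s t
    using I that by (meson mem_is_interval_1_I)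
  obtain u where u: "u \<ge> t0" "u \<notin> I" using \<open>I \<noteq> {t0..}\<close> I by auto
  have bdd: "bdd_above I" by (rule bdd_aboveI[of _ u]) (use u down in \<open>meson linear\<close>)
  define T where "T = Sup I"
  have leT: "t \<le> T" if "t \<in> I" for t unfolding T_def using that bdd by (rule cSup_upper)
  have inI: "s \<in> I" if "t0 \<le> s" "s < T" for s
  proof -
    have "s < Sup I" using that by (simp add: T_def)
    then obtain t where "t \<in> I" "s < t" using I(2) by (auto elim: less_cSupE)
    then show ?thesis using down that by auto
  qed
  show False
  proof (cases "T \<in> I")
    case True
    then have IT: "I = {t0..T}" using I leT inI by force
    obtain \<epsilon> y where y: "\<epsilon> > 0" "solution_on ?F T (x T) {T..<T + \<epsilon>} y"
      using loc[OF True] by (auto simp: locally_solvable_def)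
    \<comment> \<open>The integral equation over a one-point interval fixes the value at the
      junction.\<close>
    have "y T = x T + integral {T..T} (\<lambda>s. ?F s (y s))"
      using y unfolding solution_on_def by blast
    then have yT: "y T = x T" by simp
    define z where "z t = (if t \<le> T then x t else y t)" for t
    have "solution_on ?F t0 x0 {t0..<T + \<epsilon>} z"
    proof (rule solution_on_combine)
      show "solution_on ?F t0 x0 {t0..T} z"
        by (rule solution_on_cong[OF sol[unfolded IT]]) (simp add: z_def)
      have "solution_on ?F T (x T) {T..<T + \<epsilon>} z"
        by (rule solution_on_cong[OF y(2)]) (use yT in \<open>auto simp: z_def\<close>)
      then show "solution_on ?F T (z T) {T..<T + \<epsilon>} z" by (simp add: z_def)
    qed
    then have "{t0..<T + \<epsilon>} = I" by (rule no_ext) (use IT y(1) in \<open>auto simp: z_def\<close>)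
    moreover have "T + \<epsilon> / 2 \<in> {t0..<T + \<epsilon>}" using y(1) leT[OF I(2)] by simp
    ultimately show False using leT[of "T + \<epsilon> / 2"] y(1) by simp
  next
    case False
    then have "t0 < T" using leT[OF I(2)] I(2) by (cases "t0 = T") auto
    have IT: "I = {t0..<T}"
    proof (intro equalityI subsetI)
      fix s assume "s \<in> I"
      then show "s \<in> {t0..<T}" using leT[of s] I(3) False by (cases "s = T") auto
    qed (use inI in auto)
    obtain r where r: "r \<ge> 0" "\<And>s t. s \<in> I \<Longrightarrow> t \<in> I \<Longrightarrow> s \<le> t \<Longrightarrow>
        norm (x t) \<le> gain * (exp (- (\<gamma> / 2) * (t - s)) * norm (x s) + r)"
      using uniform_solution_bound[OF ex] sol \<open>0 \<le> t0\<close> by metis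
    define X where "X = gain * (norm (x t0) + r)"
    have X: "norm (x t) \<le> X" if "t \<in> I" for t
    proof -
      have "norm (x t) \<le> gain * (exp (- (\<gamma> / 2) * (t - t0)) * norm (x t0) + r)"
        using r(2)[OF I(2) that] that I(3) by auto
      also have "\<dots> \<le> gain * (1 * norm (x t0) + r)"
        using gain_pos \<gamma> that I(3) by (intro mult_left_mono add_right_mono mult_right_mono) auto
      finally show ?thesis by (simp add: X_def)
    qed
    have "X \<ge> 0" using X[OF I(2)] norm_ge_zero order_trans by blast
    have "continuous_on {t0..T} A" using A by (rule continuous_on_subset) (use \<open>0 \<le> t0\<close> in auto)
    then obtain K where K: "K > 0" "\<And>t v. t \<in> {t0..T} \<Longrightarrow> norm (A t *v v) \<le> K * norm v"
      by (rule matrix_function_bound) blast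
    \<comment> \<open>A majorant of the whole velocity, obtained by putting the bound
      \<open>X\<close> for the norm of the solution.\<close>
    define k where "k s = K * X + ((\<gamma> / (2 * c) + \<psi> s) * X + h s)" for s
    have "\<exists>y. (\<forall>t\<in>{t0..<T}. y t = x t) \<and> solution_on ?F t0 x0 {t0..T} y"
    proof (rule solution_on_right_end[OF sol[unfolded IT] \<open>t0 < T\<close>])
      show "k integrable_on {t0..T}"
        unfolding k_def using integral_le_halfline(1)[OF \<psi> \<open>0 \<le> t0\<close>] h_integrable[OF \<open>0 \<le> t0\<close>]
        by (intro integrable_add integrable_on_mult_left integrable_const_ivl)
          (auto simp: absolutely_integrable_on_def)
      fix s
      show "0 \<le> k s" if "s \<in> {t0..T}"
        unfolding k_def using that \<open>0 \<le> t0\<close> \<psi>(2)[of s] h(2)[of s] \<open>X \<ge> 0\<close> K(1) c \<gamma>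
        by (intro add_nonneg_nonneg mult_nonneg_nonneg) auto
      assume s: "t0 \<le> s" "s < T"
      have "norm (?F s (x s)) \<le> norm (A s *v x s) + norm (g s (x s))"
        by (simp add: perturbed_rhs_def norm_triangle_ineq)
      also have "\<dots> \<le> K * norm (x s) + ((\<gamma> / (2 * c) + \<psi> s) * norm (x s) + h s)"
        using K(2)[of s "x s"] g[of s "x s"] s \<open>0 \<le> t0\<close> by (intro add_mono) auto
      also have "\<dots> \<le> k s"
        unfolding k_def using X[OF inI[OF s]] K(1) \<psi>(2)[of s] s \<open>0 \<le> t0\<close> c \<gamma>
        by (intro add_mono mult_left_mono) auto
      finally show "norm (?F s (x s)) \<le> k s" .
    qed
    then obtain y where y: "\<forall>t\<in>{t0..<T}. y t = x t" "solution_on ?F t0 x0 {t0..T} y" by blast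
    have "{t0..T} = I" by (rule no_ext[OF y(2)]) (use y(1) IT in auto)
    then show False using False \<open>t0 < T\<close> by auto
  qed
qed

end

text \<open>Multiply \<open>\<phi> t \<le> m + H t\<close> by
  \<open>\<omega> s \<le> \<epsilon> * s + K\<close>, keeping \<phi> itself in the constant term.
  Since \<epsilon> is free, even a large level \<open>m\<close>, as for bounded \<phi>, contributes
  at most \<delta> to the linear coefficient; the rest of it is
  \<open>\<epsilon> * H\<close>.\<close>

lemma linear_growth_bound:
  fixes \<phi> \<omega> :: "real \<Rightarrow> real"
  assumes "1 \<le> p" and phi_Lp: "in_Lp (lebesgue_on {0..}) p \<phi>"
    and phi_nonneg: "\<And>t. t \<ge> 0 \<Longrightarrow> 0 \<le> \<phi> t"
    and omega_nonneg: "\<And>s. s \<ge> 0 \<Longrightarrow> 0 \<le> \<omega> s" and omega_mono: "mono_on {0..} \<omega>"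
    and l: "l \<le> 1" and omega_lim: "((\<lambda>s. \<omega> s / s powr l) \<longlongrightarrow> 0) at_top" and "\<delta> > 0"
  obtains K \<psi> where "K \<ge> 0" "\<psi> absolutely_integrable_on {0..}" "\<And>t. t \<ge> 0 \<Longrightarrow> 0 \<le> \<psi> t"
    "\<And>t s. t \<ge> 0 \<Longrightarrow> s \<ge> 0 \<Longrightarrow> \<phi> t * \<omega> s \<le> (\<delta> + \<psi> t) * s + K * \<phi> t"
proof -
  obtain m where m: "m \<ge> 0" "integrable_excess \<phi> m"
    using in_Lp_integrable_excess(1)[OF phi_Lp \<open>1 \<le> p\<close> phi_nonneg] by blast
  obtain H where H: "H absolutely_integrable_on {0..}" "\<And>t. t \<ge> 0 \<Longrightarrow> 0 \<le> H t"
    "\<And>t. t \<ge> 0 \<Longrightarrow> \<phi> t \<le> m + H t"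
    using m(2) unfolding integrable_excess_def by blast
  define \<epsilon> where "\<epsilon> = \<delta> / (m + 1)"
  have \<epsilon>: "\<epsilon> > 0" "m * \<epsilon> \<le> \<delta>" using \<open>\<delta> > 0\<close> m(1) by (auto simp: \<epsilon>_def field_simps)
  obtain K where K: "K \<ge> 0" "\<And>s. s \<ge> 0 \<Longrightarrow> \<omega> s \<le> \<epsilon> * s + K"
    using sublinear_growth[OF omega_nonneg omega_mono l omega_lim \<epsilon>(1)] by metis
  show ?thesis
  proof (rule that[OF K(1)])
    show "(\<lambda>t. \<epsilon> * H t) absolutely_integrable_on {0..}" using H(1) by simp
    show "0 \<le> \<epsilon> * H t" if "t \<ge> 0" for t using H(2)[OF that] \<epsilon>(1) by simp
    fix t s :: real assume ts: "t \<ge> 0" "s \<ge> 0"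
    have "\<phi> t * \<omega> s \<le> \<phi> t * (\<epsilon> * s + K)" using K(2)[OF ts(2)] phi_nonneg[OF ts(1)] by (rule mult_left_mono)
    also have "\<dots> = \<phi> t * (\<epsilon> * s) + K * \<phi> t" by (simp add: algebra_simps)
    also have "\<phi> t * (\<epsilon> * s) \<le> (m + H t) * (\<epsilon> * s)" using H(3)[OF ts(1)] \<epsilon>(1) ts by (intro mult_right_mono) auto
    also have "\<dots> = (m * \<epsilon> + \<epsilon> * H t) * s" by (simp add: algebra_simps)
    also have "\<dots> \<le> (\<delta> + \<epsilon> * H t) * s" using \<epsilon>(2) ts by (intro mult_right_mono) auto
    finally show "\<phi> t * \<omega> s \<le> (\<delta> + \<epsilon> * H t) * s + K * \<phi> t" by simp
  qed
qed

section \<open>Transfer to the given norm and to the stated hypotheses\<close>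

theorem theorem3p10:
  fixes N :: "real^'n \<Rightarrow> real"
    and A :: "real \<Rightarrow> real^'n^'n"
    and g :: "real \<Rightarrow> real^'n \<Rightarrow> real^'n"
    and \<phi> lam \<omega> :: "real \<Rightarrow> real"
    and p r :: ennreal
    and l :: real
  assumes norm: "is_norm N"
    and A_cont: "continuous_on {0..} A"
    and nominal: "uniformly_asymptotically_stable N A"
    and g_bound: "\<And>t x. t \<ge> 0 \<Longrightarrow> N (g t x) \<le> \<phi> t * \<omega> (N x) + lam t"
    and p: "1 \<le> p"
    and phi_nonneg: "\<And>t. t \<ge> 0 \<Longrightarrow> 0 \<le> \<phi> t"
    and phi_Lp: "in_Lp (lebesgue_on {0..}) p \<phi>"
    and omega_nonneg: "\<And>s. s \<ge> 0 \<Longrightarrow> 0 \<le> \<omega> s"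
    and omega_mono: "mono_on {0..} \<omega>"
    and omega_cont: "continuous_on {0..} \<omega>"
    and l: "0 < l" "if p = 1 then l \<le> 1 else l < 1"
    and omega_lim: "((\<lambda>s. \<omega> s / s powr l) \<longlongrightarrow> 0) at_top"
    and r: "1 \<le> r"
    and lam_nonneg: "\<And>t. t \<ge> 0 \<Longrightarrow> 0 \<le> lam t"
    and lam: "in_Lp (lebesgue_on {0..}) r lam \<or>
              (locally_integrable_halfline lam \<and> (lam \<longlongrightarrow> 0) at_top)"
  shows "(\<forall>t0\<ge>0. \<forall>x0 I x.
            maximal_solution_on (perturbed_rhs A g) t0 x0 I x \<and>
            (\<forall>s\<in>I. locally_solvable (perturbed_rhs A g) s (x s)) \<longrightarrow> I = {t0..})
       \<and> globally_practically_uniformly_exponentially_stable N (perturbed_rhs A g)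
       \<and> (p < \<infinity> \<and> r < \<infinity> \<and> in_Lp (lebesgue_on {0..}) r lam \<longrightarrow>
           (\<forall>t0\<ge>0. \<forall>x0 x. solution_on (perturbed_rhs A g) t0 x0 {t0..} x \<longrightarrow>
              ((\<lambda>t. N (x t)) \<longlongrightarrow> 0) at_top))"
proof -
  obtain a b where a: "a > 0" and b: "b > 0"
    and Na: "\<And>x. N x \<le> a * norm x" and Nb: "\<And>x. norm x \<le> b * N x"
    using is_norm_equivalent[OF norm] by metis
  have N_nonneg: "0 \<le> N x" for x using norm by (simp add: is_norm_def)
  obtain R c \<gamma> where R: "state_transition_matrix A R" and c: "c > 0" and \<gamma>: "\<gamma> > 0"
    and Rc: "\<And>t0 t. t0 \<ge> 0 \<Longrightarrow> t \<ge> t0 \<Longrightarrow> induced_norm N (R t t0) \<le> c * exp (- \<gamma> * (t - t0))"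
    using nominal unfolding uniformly_asymptotically_stable_def by blast
  \<comment> \<open>The factor \<open>a * b\<close> is the cost of passing from \<open>N\<close> to
    the Euclidean norm and back.\<close>
  define c' where "c' = a * b * c"
  have c': "c' > 0" using a b c by (simp add: c'_def)
  have decay: "norm (R t s *v v) \<le> c' * exp (- \<gamma> * (t - s)) * norm v" if "0 \<le> s" "s \<le> t" for s t v
  proof -
    have "norm (R t s *v v) \<le> b * N (R t s *v v)" by (rule Nb)
    also have "\<dots> \<le> b * (induced_norm N (R t s) * N v)"
      using b by (intro mult_left_mono le_induced_norm[OF norm]) auto
    also have "\<dots> \<le> b * ((c * exp (- \<gamma> * (t - s))) * (a * norm v))"
      using b c N_nonneg Na Rc[OF that] by (intro mult_left_mono mult_mono) auto
    finally show ?thesis by (simp add: c'_def mult_ac)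
  qed
  \<comment> \<open>The same conversion multiplies the linear coefficient by \<open>a * b\<close>;
    after it exactly \<open>\<gamma> / (2 * c')\<close> is left, as the locale demands.\<close>
  define \<delta> where "\<delta> = \<gamma> / (2 * c') / (a * b)"
  have \<delta>: "\<delta> > 0" using a b c' \<gamma> by (simp add: \<delta>_def)
  have "l \<le> 1" using l(2) by (auto split: if_splits)
  obtain K \<psi> where K: "K \<ge> 0" and \<psi>: "\<psi> absolutely_integrable_on {0..}" "\<And>t. t \<ge> 0 \<Longrightarrow> 0 \<le> \<psi> t"
    and growth: "\<And>t s. t \<ge> 0 \<Longrightarrow> s \<ge> 0 \<Longrightarrow> \<phi> t * \<omega> s \<le> (\<delta> + \<psi> t) * s + K * \<phi> t"
  proof (rule linear_growth_bound[OF p phi_Lp _ _ omega_mono \<open>l \<le> 1\<close> omega_lim \<delta>], goal_cases)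
    case (1 t) show ?case using 1(2) by (rule phi_nonneg)
  next
    case (2 s) show ?case using 2(2) by (rule omega_nonneg)
  next
    case (3 K \<psi>) show ?case using 3(2-) by (rule that)
  qed
  \<comment> \<open>The constant \<open>K\<close> in the bound for \<omega> makes \<phi> part of the
    inhomogeneity. Hence convergence to zero needs small levels for both \<phi> and
    \<open>lam\<close>.\<close>
  define h where "h t = b * (K * \<phi> t + lam t)" for t
  have h_excess: "integrable_excess h (b * (K * m + m'))"
    if "integrable_excess \<phi> m" "integrable_excess lam m'" for m m'
    unfolding h_def using that K b by (intro integrable_excess_cmult integrable_excess_add) auto
  obtain m1 where m1: "m1 \<ge> 0" "integrable_excess \<phi> m1"
    using in_Lp_integrable_excess(1)[OF phi_Lp p phi_nonneg] by blast
  have lam_excess: "\<exists>m\<ge>0. integrable_excess lam m"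
    using lam
  proof
    assume "in_Lp (lebesgue_on {0..}) r lam"
    then show ?thesis by (rule in_Lp_integrable_excess(1)) (fact r lam_nonneg)+
  next
    assume "locally_integrable_halfline lam \<and> (lam \<longlongrightarrow> 0) at_top"
    then have "integrable_excess lam 1" by (intro vanishing_integrable_excess lam_nonneg) auto
    then show ?thesis by (intro exI[of _ 1]) simp
  qed
  then obtain m2 where m2: "m2 \<ge> 0" "integrable_excess lam m2" by blast
  define m where "m = b * (K * m1 + m2)"
  have m: "integrable_excess h m" "m \<ge> 0"
    unfolding m_def using h_excess m1 m2 K b by auto
  have "locally_integrable_halfline \<phi>"
    using phi_Lp by (intro locally_integrable_halfline_excess[OF _ m1(2)] phi_nonneg) (simp_all add: in_Lp_def)
  moreover have "locally_integrable_halfline lam"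
    using lam
  proof
    assume "in_Lp (lebesgue_on {0..}) r lam"
    then show ?thesis
      by (intro locally_integrable_halfline_excess[OF _ m2(2)] lam_nonneg) (simp_all add: in_Lp_def)
  qed simp
  ultimately have h_loc: "locally_integrable_halfline h"
    unfolding locally_integrable_halfline_def h_def
    by (intro allI impI set_integrable_mult_right set_integral_add) auto
  interpret linearly_bounded_perturbation A R c' \<gamma> g "\<lambda>t. a * b * \<psi> t" h
  proof
    fix t :: real and v :: "real^'n" assume t: "0 \<le> t"
    have "norm (g t v) \<le> b * N (g t v)" by (rule Nb)
    also have "\<dots> \<le> b * (\<phi> t * \<omega> (N v) + lam t)" using b g_bound[OF t] by (intro mult_left_mono) auto
    also have "\<dots> \<le> b * ((\<delta> + \<psi> t) * N v + K * \<phi> t + lam t)"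
      using b growth[OF t N_nonneg[of v]] by (intro mult_left_mono) auto
    also have "\<dots> \<le> b * ((\<delta> + \<psi> t) * (a * norm v) + K * \<phi> t + lam t)"
      using b \<delta> \<psi>(2)[OF t] Na[of v] by (intro mult_left_mono add_right_mono) auto
    also have "\<dots> = (\<gamma> / (2 * c') + a * b * \<psi> t) * norm v + h t"
      using a b c' by (simp add: h_def \<delta>_def field_simps)
    finally show "norm (g t v) \<le> (\<gamma> / (2 * c') + a * b * \<psi> t) * norm v + h t" .
    show "0 \<le> a * b * \<psi> t" using a b \<psi>(2)[OF t] by simp
    show "0 \<le> h t" using b K phi_nonneg[OF t] lam_nonneg[OF t] by (simp add: h_def)
  qed (use A_cont R c' \<gamma> decay \<psi> h_loc in auto)
  have global: "I = {t0..}"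
    if "t0 \<ge> 0" "maximal_solution_on (perturbed_rhs A g) t0 x0 I x"
      "\<forall>s\<in>I. locally_solvable (perturbed_rhs A g) s (x s)" for t0 x0 I x
    using maximal_solution_global[OF m that(1,2)] that(3) by blast
  obtain q where q: "q \<ge> 0"
    "\<And>t0 x0 I x s t. solution_on (perturbed_rhs A g) t0 x0 I x \<Longrightarrow> 0 \<le> t0 \<Longrightarrow> s \<in> I \<Longrightarrow> t \<in> I \<Longrightarrow> s \<le> t \<Longrightarrow>
      norm (x t) \<le> gain * (exp (- (\<gamma> / 2) * (t - s)) * norm (x s) + q)"
  proof (rule uniform_solution_bound[OF m], goal_cases)
    case (1 q) show ?case using 1(2-) by (rule that)
  qed
  \<comment> \<open>The summand 1 makes the radius positive even when \<open>q\<close> is 0.\<close>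
  have "ball_GUES N (perturbed_rhs A g) (a * gain * q + 1)"
    unfolding ball_GUES_def
  proof (rule exI[of _ "\<gamma> / 2"], intro exI[of _ "a * gain * b"] conjI allI impI ballI)
    fix t0 x0 I x t assume t0: "0 \<le> (t0::real)" and sol: "solution_on (perturbed_rhs A g) t0 x0 I x" and t: "t \<in> I"
    have I: "t0 \<in> I" "t0 \<le> t" using sol t by (auto simp only: solution_on_def)
    have "x t0 = x0 + integral {t0..t0} (\<lambda>s. perturbed_rhs A g s (x s))"
      using sol I(1) unfolding solution_on_def by blast
    then have x0: "x t0 = x0" by simp
    have "N (x t) \<le> a * norm (x t)" by (rule Na)
    also have "\<dots> \<le> a * (gain * (exp (- (\<gamma> / 2) * (t - t0)) * norm x0 + q))"
      using q(2)[OF sol t0 I(1) t I(2)] a by (simp add: x0)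
    also have "\<dots> \<le> a * (gain * (exp (- (\<gamma> / 2) * (t - t0)) * (b * N x0) + q))"
      using a gain_pos Nb[of x0] by (intro mult_left_mono add_right_mono) auto
    also have "\<dots> = a * gain * b * N x0 * exp (- (\<gamma> / 2) * (t - t0)) + a * gain * q"
      by (simp add: algebra_simps)
    finally show "N (x t) \<le> a * gain * b * N x0 * exp (- (\<gamma> / 2) * (t - t0)) + (a * gain * q + 1)" by simp
  qed (use \<gamma> a b gain_pos in auto)
  moreover have "a * gain * q + 1 > 0" using a gain_pos q(1) by (simp add: add_nonneg_pos)
  ultimately have practical: "globally_practically_uniformly_exponentially_stable N (perturbed_rhs A g)"
    unfolding globally_practically_uniformly_exponentially_stable_def by blast
  have attractive: "((\<lambda>t. N (x t)) \<longlongrightarrow> 0) at_top"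
    if "p < \<infinity>" "r < \<infinity>" "in_Lp (lebesgue_on {0..}) r lam" "t0 \<ge> 0"
      and sol: "solution_on (perturbed_rhs A g) t0 x0 {t0..} x" for t0 x0 x
  proof -
    have "(x \<longlongrightarrow> 0) at_top"
    proof (rule solution_tendsto_zero[OF _ sol \<open>t0 \<ge> 0\<close>])
      fix m :: real assume "m > 0"
      \<comment> \<open>Used as the level of both \<phi> and \<open>lam\<close>, it gives
        \<open>h\<close> precisely the level \<open>m\<close>.\<close>
      define m' where "m' = m / (b * (K + 1))"
      have bK: "b * (K + 1) > 0" using b K by simp
      then have m': "m' > 0" using \<open>m > 0\<close> by (simp add: m'_def)
      have "b * (K * m' + m') = b * (K + 1) * m'" by (simp add: algebra_simps)
      also have "\<dots> = m" unfolding m'_def using bK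
        by (metis less_irrefl nonzero_mult_div_cancel_left times_divide_eq_right)
      finally have m: "b * (K * m' + m') = m" .
      have "integrable_excess \<phi> m'"
        by (rule in_Lp_integrable_excess(2)[OF phi_Lp p phi_nonneg \<open>p < \<infinity>\<close> m'])
      moreover have "integrable_excess lam m'"
        by (rule in_Lp_integrable_excess(2)[OF that(3) r lam_nonneg \<open>r < \<infinity>\<close> m'])
      ultimately show "integrable_excess h m" using h_excess m by metis
    qed
    then have "((\<lambda>t. a * norm (x t)) \<longlongrightarrow> 0) at_top"
      by (intro tendsto_mult_right_zero tendsto_norm_zero)
    then show ?thesis
      by (rule Lim_null_comparison[rotated]) (simp add: N_nonneg Na)
  qed
  show ?thesis using global practical attractive by blast
qed

end
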